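(* Let $\mu$ be a proper Borel probability measure on the sphere $S^{2}\subset\mathbb{R}^3$. Then: (A) there are three planes through the origin in $\mathbb{R}^3$ intersecting along a common line such that the six angular sectors $\sigma_1,\dots,\sigma_6$ of $S^2$ cut by the planes, listed in their cyclic order, have $\mu$-measures in the ratio $(1,1,2,1,1,2)$, i.e. $(\mu(\sigma_1),\dots,\mu(\sigma_6))=\tfrac18(1,1,2,1,1,2)$; and (B) there are three planes through the origin in $\mathbb{R}^3$ intersecting along a common line such that the six angular sectors $\sigma_1,\dots,\sigma_6$, listed in their cyclic order, have $\mu$-measures in the ratio $(1,2,2,1,2,2)$, i.e. $(\mu(\sigma_1),\dots,\mu(\sigma_6))=\tfrac1{10}(1,2,2,1,2,2)$.
   Context: A proper Borel measure on $S^{2}$ is a Borel measure $\mu$ such that $\mu([a,b])=0$ for every circular arc $[a,b]\subset S^{2}$ and $\mu(U)>0$ for every nonempty open set $U\subset S^{2}$. Three planes through the origin in $\mathbb{R}^3$ are in fan position if they intersect along a common line. Such planes cut $S^2$ into six (open) angular sectors $\sigma_1,\dots,\sigma_6$, naturally ordered up to a cyclic permutation (going around the common line). *)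

theory Defs
  imports "HOL-Analysis.Analysis" "HOL-Probability.Probability"
begin

abbreviation S2 :: "(real^3) set" where
  "S2 \<equiv> sphere 0 1"

(* Arcs of great circles, u and cos t * u + sin t * v being the endpoints a, b of [a,b].
   Arcs of small circles are not required to be null in proper_borel_measure below, so
   that notion is the most general one (the class of measures is the largest). *)
definition circular_arc :: "(real^3) set \<Rightarrow> bool" where
  "circular_arc A \<longleftrightarrow> (\<exists>u v t. norm u = 1 \<and> norm v = 1 \<and> u \<bullet> v = 0 \<and> 0 \<le> t \<and> t < 2 * pi \<and>
     A = (\<lambda>\<phi>. cos \<phi> *\<^sub>R u + sin \<phi> *\<^sub>R v) ` {0..t})"

definition proper_borel_measure :: "(real^3) measure \<Rightarrow> bool" where
  "proper_borel_measure \<mu> \<longleftrightarrow>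
     sets \<mu> = sets (restrict_space borel S2) \<and>
     (\<forall>A. circular_arc A \<longrightarrow> emeasure \<mu> A = 0) \<and>
     (\<forall>U. openin (top_of_set S2) U \<longrightarrow> U \<noteq> {} \<longrightarrow> emeasure \<mu> U > 0)"

definition plane_through_origin :: "(real^3) set \<Rightarrow> bool" where
  "plane_through_origin P \<longleftrightarrow> subspace P \<and> dim P = 2"

(* Distinctness is what makes the planes cut the sphere into six sectors; together with
   dim (P \<inter> Q \<inter> R) = 1 it makes all pairwise intersections equal to the common line. *)
definition fan_position :: "(real^3) set \<Rightarrow> (real^3) set \<Rightarrow> (real^3) set \<Rightarrow> bool" where
  "fan_position P Q R \<longleftrightarrow>
     plane_through_origin P \<and> plane_through_origin Q \<and> plane_through_origin R \<and>
     P \<noteq> Q \<and> Q \<noteq> R \<and> P \<noteq> R \<and> dim (P \<inter> Q \<inter> R) = 1"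

definition orthonormal_frame :: "real^3 \<Rightarrow> real^3 \<Rightarrow> real^3 \<Rightarrow> bool" where
  "orthonormal_frame u v w \<longleftrightarrow> norm u = 1 \<and> norm v = 1 \<and> norm w = 1 \<and>
     u \<bullet> v = 0 \<and> u \<bullet> w = 0 \<and> v \<bullet> w = 0"

(* Points of the sphere off the w-axis whose angle around that axis, measured from u
   towards v, lies strictly between s and t. *)
definition angular_sector :: "real^3 \<Rightarrow> real^3 \<Rightarrow> real^3 \<Rightarrow> real \<Rightarrow> real \<Rightarrow> (real^3) set" where
  "angular_sector u v w s t =
     {x \<in> S2. \<exists>r \<phi> z. 0 < r \<and> s < \<phi> \<and> \<phi> < t \<and>
        x = r *\<^sub>R (cos \<phi> *\<^sub>R u + sin \<phi> *\<^sub>R v) + z *\<^sub>R w}"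

(* The list \<sigma> enumerates the pieces into which the planes cut the sphere, in the order met
   when going once around the common line (spanned by w), from any starting piece and in
   either direction. *)
definition cyclic_sectors ::
  "(real^3) set \<Rightarrow> (real^3) set \<Rightarrow> (real^3) set \<Rightarrow> (real^3) set list \<Rightarrow> bool" where
  "cyclic_sectors P Q R \<sigma> \<longleftrightarrow>
     length \<sigma> = 6 \<and> distinct \<sigma> \<and> set \<sigma> = components (S2 - (P \<union> Q \<union> R)) \<and>
     (\<exists>u v w \<tau>. orthonormal_frame u v w \<and> w \<in> P \<inter> Q \<inter> R \<and>
        (\<forall>i<6. \<tau> i < \<tau> (Suc i)) \<and> \<tau> 6 = \<tau> 0 + 2 * pi \<and>
        (\<forall>i<6. \<sigma> ! i = angular_sector u v w (\<tau> i) (\<tau> (Suc i))))"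

end

theory Submission imports Defs begin

text \<open>
  Both parts are the cases \<open>p = 1/8\<close> and \<open>p = 1/5\<close> of one statement: for \<open>0 < p < 1/4\<close> some fan cuts the
  sphere into sectors of measures \<open>p, p, 1/2 - 2p, p, p, 1/2 - 2p\<close> (lemma \<open>balanced_fan\<close>).

  A flag is an orthonormal pair \<open>(u, v)\<close>. It stands for the axis \<open>u \<times> v\<close>, the half-plane leaving the axis in
  direction \<open>u\<close>, and the hemisphere around \<open>v\<close>, whose boundary lies in the plane of this half-plane. Let \<open>h v\<close> be the measure of
  that hemisphere minus \<open>1/2\<close>, an odd function of \<open>v\<close>, and let \<open>A u v\<close> be the angle through which the half-plane
  must turn from \<open>u\<close> towards \<open>v\<close> in order to sweep mass \<open>p\<close>. The angle is unique because open sets have positive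
  measure, and continuous because great circles are null. If \<open>h v = 0\<close>, \<open>A (-u) (-v) = A u v\<close> and
  \<open>A u (-v) = A (-u) v\<close>, then the plane through the axis and \<open>u\<close> halves the measure, and the half-planes that
  sweep mass \<open>p\<close> from it in the two directions extend to planes doing the same on the opposite side.
  These three planes form the required fan.

  Put the two differences \<open>b = A (-u) (-v) - A u v\<close> and \<open>c = A u (-v) - A (-u) v\<close> into the complex number
  \<open>F u v = (b + c) + (b - c) \<i>\<close>. Changing the sign of \<open>u\<close> conjugates \<open>F\<close>, and changing the sign of \<open>v\<close> turns
  it into \<open>- cnj F\<close>. What is needed is therefore a Borsuk-Ulam type theorem: an odd function \<open>h\<close> of \<open>v\<close> and a
  function \<open>F\<close> of flags with these symmetries have a common zero (lemma \<open>equivariant_flag_map_zero\<close>). It is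
  proved with continuous logarithms only.

  For each \<open>\<delta> > 0\<close> some path joins a vector to its antipode inside \<open>\<bar>h\<bar> < \<delta>\<close>; otherwise one could
  choose one of each two antipodal components of this region and complete \<open>h\<close> to a nowhere vanishing odd map
  to the complex plane, which has no logarithm on a simply connected space compatible with oddness.
  The flags over this path form a Klein bottle, because the plane orthogonal to \<open>v\<close> comes back with reversed
  orientation. A nowhere vanishing \<open>F\<close> on it would have a logarithm on the universal cover whose periods
  satisfy an impossible parity condition (lemma \<open>conjugation_equivariant_map_has_zero\<close>). So \<open>F\<close> has zeros with
  \<open>\<bar>h\<bar>\<close> arbitrarily small, and compactness of the set of flags gives one with \<open>h = 0\<close>.
\<close>

section \<open>Antipodal paths and a Klein-bottle argument\<close>

lemma exp_const_imp_constant_on: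
  fixes g :: "'a::topological_space \<Rightarrow> complex"
  assumes "connected S" "continuous_on S g" and exp: "\<And>x. x \<in> S \<Longrightarrow> exp (g x) = c"
  shows "g constant_on S"
proof (rule continuous_discrete_range_constant[OF assms(1,2)])
  fix x assume "x \<in> S"
  have "2 * pi \<le> norm (g y - g x)" if "y \<in> S" "g y \<noteq> g x" for y
  proof -
    have "exp (g y) = exp (g x)" using exp that \<open>x \<in> S\<close> by simp
    then obtain n :: int where n: "g y = g x + complex_of_real (of_int (2 * n) * pi) * \<i>"
      unfolding exp_eq by blast
    with that have "\<bar>n\<bar> \<ge> 1" by (cases "n = 0") auto
    have "norm (g y - g x) = \<bar>real_of_int n\<bar> * (2 * pi)"
      unfolding n by (simp add: norm_mult abs_mult)
    moreover have "\<bar>real_of_int n\<bar> \<ge> 1" using \<open>\<bar>n\<bar> \<ge> 1\<close> by linarith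
    ultimately show ?thesis by simp
  qed
  moreover have "2 * pi > 0" by simp
  ultimately show "\<exists>e>0. \<forall>y. y \<in> S \<and> g y \<noteq> g x \<longrightarrow> e \<le> norm (g y - g x)" by metis
qed

text \<open>
  The consequence of Borsuk-Ulam for maps to the plane: for a logarithm \<open>g\<close> of a nowhere vanishing odd map,
  \<open>g (-x) - g x\<close> is a constant that is odd, hence zero, although its exponential is \<open>-1\<close>.
\<close>
lemma odd_complex_map_has_zero:
  fixes K :: "'a::euclidean_space \<Rightarrow> complex"
  assumes dim: "3 \<le> DIM('a)" and cont: "continuous_on (- {0}) K" and odd: "\<And>x. x \<noteq> 0 \<Longrightarrow> K (- x) = - K x"
  shows "\<exists>x. x \<noteq> 0 \<and> K x = 0"
proof (rule ccontr)
  assume "\<not> ?thesis"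
  then have nz: "\<And>x. x \<in> - {0} \<Longrightarrow> K x \<noteq> 0" by auto
  have sc: "simply_connected (- {0::'a})"
    using dim by (rule simply_connected_punctured_universe)
  have lp: "locally path_connected (- {0::'a})"
    by (rule open_imp_locally_path_connected[OF open_Compl]) simp
  obtain g where g: "continuous_on (- {0}) g" "\<And>x. x \<in> - {0} \<Longrightarrow> K x = exp (g x)"
    using continuous_logarithm_on_simply_connected[OF cont sc lp nz] by blast
  let ?d = "\<lambda>x. g (- x) - g x"
  have "exp (?d x) = -1" if "x \<noteq> 0" for x
    using g(2)[of x] g(2)[of "- x"] odd[of x] nz[of x] that
    by (metis (no_types, lifting) ComplI exp_diff exp_not_eq_zero minus_divide_left nonzero_divide_eq_eq
        neg_equal_0_iff_equal singletonD mult_minus1)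
  moreover have "continuous_on (- {0}) ?d"
    by (intro continuous_intros continuous_on_compose2[OF g(1)] g(1)) auto
  ultimately have "?d constant_on (- {0})"
    using exp_const_imp_constant_on[of "- {0}" ?d "-1"] simply_connected_imp_connected[OF sc] by auto
  then obtain c where c: "\<And>x. x \<noteq> 0 \<Longrightarrow> ?d x = c" unfolding constant_on_def by auto
  define e :: 'a where "e = (SOME i. i \<in> Basis)"
  have "e \<noteq> 0" by (simp add: e_def SOME_Basis nonzero_Basis)
  with c[of e] c[of "- e"] have "?d e = 0" by (simp add: algebra_simps)
  with \<open>\<And>x. x \<noteq> 0 \<Longrightarrow> exp (?d x) = -1\<close>[of e] \<open>e \<noteq> 0\<close> show False by simp
qed

text \<open>
  The zero set of an odd function separates antipodes, so a neighbourhood \<open>U\<close> of it should have an antipodally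
  symmetric component. If no component of \<open>U\<close> is symmetric, they come in antipodal pairs.
  Let \<open>V\<close> consist of one component from each pair, and let \<open>k\<close> be \<open>\<delta> - \<bar>h\<bar>\<close> on \<open>V\<close>, its negative
  on the other components, and \<open>0\<close> outside \<open>U\<close>. Then \<open>k\<close> is odd and continuous and does not vanish
  where \<open>h\<close> does, so \<open>h + k \<i>\<close> contradicts the preceding lemma.
\<close>
lemma antipodal_points_in_component:
  fixes h :: "'a::euclidean_space \<Rightarrow> real"
  assumes dim: "3 \<le> DIM('a)" and cont: "continuous_on (- {0}) h" and odd: "\<And>x. x \<noteq> 0 \<Longrightarrow> h (- x) = - h x" and "\<delta> > 0"
  defines "U \<equiv> {x. x \<noteq> 0 \<and> \<bar>h x\<bar> < \<delta>}"
  shows "\<exists>x. connected_component U x (- x)"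
proof (rule ccontr)
  assume no: "\<not> ?thesis"
  let ?C = "connected_component_set U"
  have op: "open (- {0::'a})" by (rule open_Compl) simp
  have U_eq: "U = (- {0}) \<inter> (\<lambda>x. \<bar>h x\<bar>) -` {..<\<delta>}" by (auto simp: U_def)
  have openU: "open U"
    unfolding U_eq
    by (rule continuous_open_preimage[OF _ op]) (auto intro!: continuous_on_rabs cont)
  have U_minus: "- x \<in> U" if "x \<in> U" for x using that odd by (auto simp: U_def)
  have minus_image: "uminus ` ?C x \<subseteq> ?C (- x)" for x
  proof (cases "x \<in> U")
    case True
    have "connected (uminus ` ?C x)"
      by (intro connected_continuous_image continuous_intros) simp
    moreover have "uminus ` ?C x \<subseteq> U" using connected_component_subset[of U x] U_minus by auto
    moreover have "- x \<in> uminus ` ?C x" using True by (simp add: connected_component_refl)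
    ultimately show ?thesis by (rule connected_component_maximal[rotated 1])
  next
    case False
    then show ?thesis by (simp add: connected_component_eq_empty[THEN iffD2])
  qed
  have minus_C: "uminus ` ?C x = ?C (- x)" for x
  proof
    have "uminus ` (uminus ` ?C (- x)) \<subseteq> uminus ` ?C x"
      using minus_image[of "- x"] by (intro image_mono) simp
    then show "?C (- x) \<subseteq> uminus ` ?C x" by (simp add: image_image)
  qed (rule minus_image)
  have C_ne: "?C (- x) \<noteq> ?C x" if "x \<in> U" for x
    using no that U_minus[of x] connected_component_refl[of "- x" U] by auto
  (* The choice depends only on the unordered pair of components, so x and -x get the same one. *)
  define rep where "rep x = (SOME A. A \<in> {?C x, ?C (- x)})" for x
  have rep_in: "rep x \<in> {?C x, ?C (- x)}" for x
    unfolding rep_def by (rule someI[of _ "?C x"]) simp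
  have rep_minus: "rep (- x) = rep x" for x
    unfolding rep_def by (simp add: insert_commute)
  have C_cong: "?C y = ?C x" "?C (- y) = ?C (- x)" if "y \<in> ?C x" for x y
  proof -
    show 1: "?C y = ?C x" using that connected_component_eq[of y U x] by simp
    show "?C (- y) = ?C (- x)" unfolding minus_C[symmetric] 1 ..
  qed
  have rep_cong: "rep y = rep x" if "y \<in> ?C x" for x y
    unfolding rep_def C_cong[OF that] ..
  define V where "V = {x \<in> U. rep x = ?C x}"
  have V_iff: "x \<in> V \<longleftrightarrow> x \<in> U \<and> rep x = ?C x" for x by (simp only: V_def mem_Collect_eq)
  have openV: "open V"
  proof (subst open_subopen, intro ballI)
    fix x assume x: "x \<in> V"
    have "open (?C x)" using openU by (rule open_connected_component)
    moreover have "x \<in> ?C x" using x V_iff connected_component_refl by blast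
    moreover have "?C x \<subseteq> V"
    proof (rule subsetI)
      fix y assume y: "y \<in> ?C x"
      then have "y \<in> U" using connected_component_subset[of U x] by blast
      moreover have "rep y = ?C y" using rep_cong[OF y] C_cong(1)[OF y] x V_iff by metis
      ultimately show "y \<in> V" using V_iff by blast
    qed
    ultimately show "\<exists>T. open T \<and> x \<in> T \<and> T \<subseteq> V" by blast
  qed
  have V_minus: "- x \<in> V \<longleftrightarrow> x \<notin> V" if "x \<in> U" for x
  proof -
    have "- x \<in> V \<longleftrightarrow> rep x = ?C (- x)" using U_minus[OF that] rep_minus[of x] V_iff by metis
    moreover have "x \<in> V \<longleftrightarrow> rep x = ?C x" using that V_iff by metis
    moreover have "rep x = ?C x \<or> rep x = ?C (- x)" using rep_in[of x] by blast
    ultimately show ?thesis using C_ne[OF that] by metis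
  qed
  have openV': "open (uminus ` V)" using openV by (rule open_negations)
  have V'_iff: "x \<in> uminus ` V \<longleftrightarrow> x \<in> U \<and> x \<notin> V" for x
  proof -
    have "x \<in> uminus ` V \<longleftrightarrow> - x \<in> V" by force
    also have "\<dots> \<longleftrightarrow> x \<in> U \<and> x \<notin> V"
      using V_minus[of x] U_minus[of "- x"] V_iff minus_minus[of x] by metis
    finally show ?thesis .
  qed
  define m where "m x = max 0 (\<delta> - \<bar>h x\<bar>)" for x
  define k where "k x = (if x \<in> V then m x else - m x)" for x
  have m_cont: "continuous_on (- {0}) m" unfolding m_def by (intro continuous_intros cont)
  have m_pos: "m x > 0 \<longleftrightarrow> x \<in> U" if "x \<noteq> 0" for x
    using that \<open>\<delta> > 0\<close> by (auto simp: m_def U_def)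
  have m_at: "isCont m x" if "x \<noteq> 0" for x
    using that m_cont continuous_on_eq_continuous_at[OF op, of m] by simp
  have "isCont k x" if "x \<noteq> 0" for x
  proof (cases "x \<in> U")
    case True
    show ?thesis
    proof (cases "x \<in> V")
      case True
      have "\<forall>\<^sub>F y in nhds x. k y = m y"
        using eventually_nhds_in_open[OF openV True] by eventually_elim (simp add: k_def)
      with m_at[OF that] show ?thesis by (simp add: isCont_cong)
    next
      case False
      with True have x: "x \<in> uminus ` V" using V'_iff by blast
      have "\<forall>\<^sub>F y in nhds x. k y = - m y"
        using eventually_nhds_in_open[OF openV' x] by eventually_elim (simp add: k_def V'_iff)
      moreover have "isCont (\<lambda>y. - m y) x" using m_at[OF that] by (rule continuous_minus)
      ultimately show ?thesis by (simp add: isCont_cong)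
    qed
  next
    case False
    then have "m x = 0" using m_pos[OF that] by (auto simp: m_def)
    then have k0: "k x = 0" by (simp add: k_def)
    have "(m \<longlongrightarrow> 0) (at x)" using m_at[OF that] \<open>m x = 0\<close> by (simp add: isCont_def)
    moreover have "\<bar>k y\<bar> \<le> m y" for y by (auto simp: k_def m_def)
    ultimately have "(k \<longlongrightarrow> 0) (at x)"
      by (intro Lim_null_comparison[of k m]) (auto intro: always_eventually)
    then show ?thesis by (simp add: isCont_def k0)
  qed
  then have k_cont: "continuous_on (- {0}) k" by (intro continuous_at_imp_continuous_on) auto
  have m_minus: "m (- x) = m x" if "x \<noteq> 0" for x using odd[OF that] by (simp add: m_def)
  have k_odd: "k (- x) = - k x" if "x \<noteq> 0" for x
  proof (cases "x \<in> U")
    case True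
    then show ?thesis using V_minus[of x] m_minus[OF that] by (auto simp: k_def)
  next
    case False
    then have "m x = 0" using m_pos[OF that] by (auto simp: m_def)
    then show ?thesis using m_minus[OF that] by (simp add: k_def)
  qed
  have "continuous_on (- {0}) (\<lambda>x. Complex (h x) (k x))"
    unfolding Complex_eq by (intro continuous_intros cont k_cont)
  moreover have "Complex (h (- x)) (k (- x)) = - Complex (h x) (k x)" if "x \<noteq> 0" for x
    using odd[OF that] k_odd[OF that] by (simp add: complex_eq_iff)
  ultimately have "\<exists>x. x \<noteq> 0 \<and> Complex (h x) (k x) = 0" by (rule odd_complex_map_has_zero[OF dim])
  then obtain x where x: "x \<noteq> 0" "h x = 0" "k x = 0" by (auto simp: complex_eq_iff)
  then have "x \<in> U" using \<open>\<delta> > 0\<close> by (simp add: U_def)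
  with m_pos[OF x(1)] x(3) show False by (auto simp: k_def split: if_splits)
qed

text \<open>
  A polynomial path is smooth, so that the cone over it is a null set; this will provide a frame along it.
\<close>
lemma antipodal_polynomial_path:
  fixes h :: "'a::euclidean_space \<Rightarrow> real"
  assumes dim: "3 \<le> DIM('a)" and cont: "continuous_on (- {0}) h" and odd: "\<And>x. x \<noteq> 0 \<Longrightarrow> h (- x) = - h x" and "\<delta> > 0"
  obtains g :: "real \<Rightarrow> 'a" where "polynomial_function g" "g 1 = - g 0"
    "\<And>t. t \<in> {0..1} \<Longrightarrow> g t \<noteq> 0 \<and> \<bar>h (g t)\<bar> < \<delta>"
proof -
  define U where "U = {x. x \<noteq> 0 \<and> \<bar>h x\<bar> < \<delta>}"
  have "U = (- {0}) \<inter> (\<lambda>x. \<bar>h x\<bar>) -` {..<\<delta>}" by (auto simp: U_def)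
  then have openU: "open U"
    using continuous_open_preimage[OF continuous_on_rabs[OF cont] open_Compl[OF closed_singleton] open_lessThan]
    by simp
  obtain x where x: "connected_component U x (- x)"
    using antipodal_points_in_component[OF assms] unfolding U_def by blast
  let ?C = "connected_component_set U x"
  have "x \<in> ?C" "- x \<in> ?C" using x connected_component_in[OF x] connected_component_refl[of x U] by simp_all
  then obtain g where g: "polynomial_function g" "path_image g \<subseteq> ?C" "pathstart g = x" "pathfinish g = - x"
    using connected_open_polynomial_connected[OF open_connected_component[OF openU] connected_connected_component]
    by blast
  show thesis
  proof
    show "polynomial_function g" by fact
    show "g 1 = - g 0" using g by (simp add: pathstart_def pathfinish_def)
    fix t :: real assume "t \<in> {0..1}"
    then have "g t \<in> ?C" using g(2) unfolding path_image_def by blast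
    then have "g t \<in> U" using connected_component_subset[of U x] by blast
    then show "g t \<noteq> 0 \<and> \<bar>h (g t)\<bar> < \<delta>" by (simp add: U_def)
  qed
qed

text \<open>
  The strip \<open>{0..1} \<times> \<real>\<close>, with \<open>\<phi>\<close> taken modulo \<open>2\<pi>\<close> and \<open>(0, \<phi>)\<close> glued to
  \<open>(1, -\<phi>)\<close>, is a Klein bottle. For a logarithm \<open>g\<close> of a nowhere vanishing \<open>F\<close>, the two symmetries
  say that \<open>g\<close> changes by conjugation and a constant: \<open>k\<close>, an even multiple of \<open>\<pi>\<i>\<close>, for the half turn,
  and \<open>l\<close>, an odd multiple, for the gluing. Since the gluing reverses the half turn, the two ways of composing them
  give \<open>l = cnj l + 2 k\<close>, that is \<open>l = k\<close>.
\<close>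
lemma conjugation_equivariant_map_has_zero:
  fixes F :: "real \<Rightarrow> real \<Rightarrow> complex"
  assumes cont: "continuous_on ({0..1} \<times> UNIV) (\<lambda>(t, \<phi>). F t \<phi>)"
    and half_turn: "\<And>t \<phi>. t \<in> {0..1} \<Longrightarrow> F t (\<phi> + pi) = cnj (F t \<phi>)"
    and ends: "\<And>\<phi>. F 1 (- \<phi>) = - cnj (F 0 \<phi>)"
  shows "\<exists>t\<in>{0..1}. \<exists>\<phi>. F t \<phi> = 0"
proof (rule ccontr)
  assume "\<not> ?thesis"
  then have nz: "\<And>t \<phi>. t \<in> {0..1} \<Longrightarrow> F t \<phi> \<noteq> 0" by auto
  let ?S = "{0..1::real} \<times> (UNIV :: real set)"
  have cvx: "convex ?S" by (intro convex_Times) auto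
  obtain G where G: "continuous_on ?S G" "\<And>x. x \<in> ?S \<Longrightarrow> (\<lambda>(t, \<phi>). F t \<phi>) x = exp (G x)"
  proof (rule continuous_logarithm_on_contractible[OF cont convex_imp_contractible[OF cvx]])
    show "(\<lambda>(t, \<phi>). F t \<phi>) x \<noteq> 0" if "x \<in> ?S" for x using nz that by (cases x) simp
  qed (rule that)
  define g where "g t \<phi> = G (t, \<phi>)" for t \<phi>
  have Fg: "F t \<phi> = exp (g t \<phi>)" if "t \<in> {0..1}" for t \<phi>
    using G(2)[of "(t, \<phi>)"] that by (simp add: g_def)
  have "(\<lambda>x. G (fst x, snd x + pi) - cnj (G x)) constant_on ?S"
  proof (rule exp_const_imp_constant_on[OF convex_connected[OF cvx]])
    show "continuous_on ?S (\<lambda>x. G (fst x, snd x + pi) - cnj (G x))"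
      by (intro continuous_intros continuous_on_compose2[OF G(1)] G(1)) auto
    fix x assume "x \<in> ?S"
    then show "exp (G (fst x, snd x + pi) - cnj (G x)) = 1"
      using Fg[of "fst x" "snd x + pi"] Fg[of "fst x" "snd x"] half_turn[of "fst x" "snd x"] nz[of "fst x" "snd x"]
      by (auto simp: g_def exp_diff exp_cnj)
  qed
  then obtain k where "\<And>x. x \<in> ?S \<Longrightarrow> G (fst x, snd x + pi) - cnj (G x) = k"
    unfolding constant_on_def by blast
  from this[of "(t, \<phi>)" for t \<phi>]
  have k: "g t (\<phi> + pi) = cnj (g t \<phi>) + k" if "t \<in> {0..1}" for t \<phi>
    using that by (simp add: g_def diff_eq_eq add.commute[of _ k])
  have "(\<lambda>\<phi>. G (1, - \<phi>) - cnj (G (0, \<phi>))) constant_on UNIV"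
  proof (rule exp_const_imp_constant_on)
    show "continuous_on UNIV (\<lambda>\<phi>. G (1, - \<phi>) - cnj (G (0, \<phi>)))"
      by (intro continuous_intros continuous_on_compose2[OF G(1)]) auto
    fix \<phi> :: real
    show "exp (G (1, - \<phi>) - cnj (G (0, \<phi>))) = -1"
      using Fg[of 1 "- \<phi>"] Fg[of 0 "\<phi>"] ends[of \<phi>] nz[of 0 \<phi>]
      by (simp add: g_def exp_diff exp_cnj[symmetric] divide_eq_eq)
  qed simp
  then obtain l where "\<And>\<phi>. G (1, - \<phi>) - cnj (G (0, \<phi>)) = l"
    unfolding constant_on_def by blast
  then have l: "g 1 (- \<phi>) = cnj (g 0 \<phi>) + l" for \<phi>
    by (simp add: g_def diff_eq_eq add.commute[of _ l])
  have E: "exp k = 1" "exp l = -1"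
  proof -
    have "exp (g 0 pi) = exp (cnj (g 0 0)) * exp k" using k[of 0 0] by (simp add: exp_add)
    then show "exp k = 1"
      using Fg[of 0 0] Fg[of 0 pi] half_turn[of 0 0] nz[of 0 0] by (simp add: exp_cnj)
    have "exp (g 1 0) = exp (cnj (g 0 0)) * exp l" using l[of 0] by (simp add: exp_add)
    then have "exp (cnj (g 0 0)) * exp l = exp (cnj (g 0 0)) * (-1)"
      using Fg[of 0 0] Fg[of 1 0] ends[of 0] by (simp add: exp_cnj)
    then show "exp l = -1" unfolding mult_cancel_left by simp
  qed
  (* Passing from (1, 0) to (0, 0) by a half turn, a gluing and a half turn, instead of by one
     gluing: the gluing then stands under one conjugation, and the shifts k add up. *)
  have "g 1 0 = cnj (g 1 (- pi)) + k" using k[of 1 "- pi"] by simp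
  also have "g 1 (- pi) = cnj (g 0 pi) + l" by (rule l)
  also have "g 0 pi = cnj (g 0 0) + k" using k[of 0 0] by simp
  finally have "l = cnj l + 2 * k" using l[of 0] by (simp add: algebra_simps)
  obtain m :: int where m: "k = of_int (2 * m) * pi * \<i>"
  proof -
    obtain m :: int where "Re k = 0" "Im k = of_int (2 * m) * pi" using E(1) unfolding exp_eq_1 by blast
    then show thesis by (intro that[of m]) (simp add: complex_eq_iff)
  qed
  have "exp (l - pi * \<i>) = 1" using E(2) by (simp add: exp_diff)
  then obtain n :: int where n: "Im (l - pi * \<i>) = of_int (2 * n) * pi"
    unfolding exp_eq_1 by blast
  have "Im l = pi + 2 * n * pi" "Im k = 2 * m * pi" using n by (simp_all add: m)
  moreover have "Im (cnj l + 2 * k) = - Im l + 2 * Im k" by simp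
  ultimately have "Im l = Im k" "Im l = pi + 2 * n * pi" "Im k = 2 * m * pi"
    using arg_cong[OF \<open>l = cnj l + 2 * k\<close>, of Im] by linarith+
  then have "(1 + 2 * real_of_int n) * pi = (2 * real_of_int m) * pi" by (simp add: algebra_simps)
  then have "real_of_int (1 + 2 * n) = real_of_int (2 * m)" by simp
  then have "1 + 2 * n = 2 * m" unfolding of_int_eq_iff .
  then show False by presburger
qed

section \<open>Orthonormal frames and flags\<close>

lemma frame_inner:
  assumes "orthonormal_frame u v w"
  shows "u \<bullet> u = 1" "v \<bullet> v = 1" "w \<bullet> w = 1" "u \<bullet> v = 0" "u \<bullet> w = 0" "v \<bullet> w = 0"
    "v \<bullet> u = 0" "w \<bullet> u = 0" "w \<bullet> v = 0"
  using assms by (auto simp: orthonormal_frame_def dot_square_norm inner_commute)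

lemma frame_expansion:
  assumes f: "orthonormal_frame u v w"
  shows "x = (x \<bullet> u) *\<^sub>R u + (x \<bullet> v) *\<^sub>R v + (x \<bullet> w) *\<^sub>R w"
proof -
  note fi = frame_inner[OF f]
  have ne: "u \<noteq> v" "u \<noteq> w" "v \<noteq> w" "0 \<notin> {u, v, w}" using fi by auto
  have po: "pairwise orthogonal {u, v, w}" using fi by (auto simp: pairwise_def orthogonal_def)
  have ind: "independent {u, v, w}" by (rule pairwise_orthogonal_independent[OF po ne(4)])
  have "card {u, v, w} = 3" using ne by simp
  then have "UNIV \<subseteq> span {u, v, w}" by (intro card_ge_dim_independent[OF subset_UNIV ind]) simp
  then have "x \<in> span {u, v, w}" by blast
  then have "(\<Sum>b\<in>{u, v, w}. (x \<bullet> b) *\<^sub>R b) = x"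
    using f by (intro orthonormal_basis_expand po) (auto simp: orthonormal_frame_def)
  moreover have "(\<Sum>b\<in>{u, v, w}. (x \<bullet> b) *\<^sub>R b) = (x \<bullet> u) *\<^sub>R u + (x \<bullet> v) *\<^sub>R v + (x \<bullet> w) *\<^sub>R w"
    using ne by (simp add: add.assoc)
  ultimately show ?thesis by metis
qed

lemma cross3_frame:
  assumes "norm u = 1" "norm v = 1" "u \<bullet> v = 0"
  shows "orthonormal_frame u v (cross3 u v)"
proof -
  have "(norm (cross3 u v))\<^sup>2 = 1\<^sup>2" using assms by (simp add: norm_cross)
  then have "norm (cross3 u v) = 1" by (rule power2_eq_imp_eq) simp_all
  then show ?thesis using assms by (simp add: orthonormal_frame_def dot_cross_self)
qed

definition flags :: "((real^3) \<times> (real^3)) set" where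
  "flags = {(u, v). norm u = 1 \<and> norm v = 1 \<and> u \<bullet> v = 0}"

lemma flags_iff: "(u, v) \<in> flags \<longleftrightarrow> norm u = 1 \<and> norm v = 1 \<and> u \<bullet> v = 0"
  by (simp add: flags_def)

lemma compact_flags: "compact flags"
proof -
  have "closed {x :: (real^3) \<times> (real^3). fst x \<bullet> snd x = 0}"
    by (intro closed_Collect_eq continuous_intros)
  then have "compact ((S2 \<times> S2) \<inter> {x. fst x \<bullet> snd x = 0})"
    by (intro compact_Int_closed compact_Times compact_sphere)
  moreover have "flags = (S2 \<times> S2) \<inter> {x. fst x \<bullet> snd x = 0}"
    by (simp add: flags_def set_eq_iff split_paired_all)
  ultimately show ?thesis by (simp only:)
qed

text \<open>
  The cone over a smooth path in space is negligible, so some vector \<open>e\<close> is never parallel to \<open>g t\<close>.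
  Its component orthogonal to \<open>g t\<close> gives \<open>a\<close>, which takes the same value at the antipodal ends; the cross product
  with \<open>g t\<close> gives \<open>b\<close>, which therefore changes sign.
\<close>
lemma frame_along_polynomial_path:
  fixes g :: "real \<Rightarrow> real^3"
  assumes poly: "polynomial_function g" and "g 1 = - g 0" and nz: "\<And>t. t \<in> {0..1} \<Longrightarrow> g t \<noteq> 0"
  obtains a b where "continuous_on {0..1} a" "continuous_on {0..1} b"
    "\<And>t. t \<in> {0..1} \<Longrightarrow> orthonormal_frame (a t) (b t) (sgn (g t))"
    "a 1 = a 0" "b 1 = - b 0"
proof -
  define cone where "cone = (\<lambda>x. fst x *\<^sub>R g (snd x)) ` (UNIV :: (real \<times> real) set)"
  have g_diff: "(\<lambda>x::real\<times>real. g (snd x)) differentiable_on UNIV"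
    unfolding differentiable_on_def
    using differentiable_chain_at[OF bounded_linear_imp_differentiable[OF bounded_linear_snd]
        differentiable_at_polynomial_function[OF poly]]
    by (auto simp: o_def intro: differentiable_at_withinI)
  have "(\<lambda>x. fst x *\<^sub>R g (snd x)) differentiable_on (UNIV :: (real \<times> real) set)"
    by (rule differentiable_on_scaleR[OF bounded_linear_imp_differentiable_on[OF bounded_linear_fst] g_diff])
  then have "negligible cone"
    unfolding cone_def by (rule negligible_differentiable_image_lowdim[rotated]) simp
  then have "cone \<noteq> UNIV" using non_negligible_UNIV by metis
  then obtain e where "e \<notin> cone" by blast
  then have e: "s *\<^sub>R g t \<noteq> e" for s t
    using image_eqI[of e "\<lambda>x. fst x *\<^sub>R g (snd x)" "(s, t)" UNIV] by (auto simp: cone_def)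
  define V where "V t = sgn (g t)" for t
  define A where "A t = e - (e \<bullet> V t) *\<^sub>R V t" for t
  have norm_V: "norm (V t) = 1" if "t \<in> {0..1}" for t using nz[OF that] by (simp add: V_def norm_sgn)
  have A_nz: "A t \<noteq> 0" for t
  proof
    assume "A t = 0"
    then have "e = (e \<bullet> V t) *\<^sub>R V t" unfolding A_def by (rule eq_iff_diff_eq_0[THEN iffD2])
    also have "\<dots> = ((e \<bullet> V t) / norm (g t)) *\<^sub>R g t" by (simp add: V_def sgn_div_norm divide_inverse)
    finally show False using e by metis
  qed
  have AV: "A t \<bullet> V t = 0" if "t \<in> {0..1}" for t
    using norm_V[OF that] by (simp add: A_def inner_diff_left dot_square_norm)
  have V_cont: "continuous_on {0..1} V"
    unfolding V_def using nz
    by (intro continuous_on_sgn continuous_on_polymonial_function[OF poly]) auto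
  have A_cont: "continuous_on {0..1} A" unfolding A_def by (intro continuous_intros V_cont)
  have V1: "V 1 = - V 0" by (simp add: V_def assms(2) sgn_minus)
  show thesis
  proof
    show a: "continuous_on {0..1} (\<lambda>t. sgn (A t))"
      by (intro continuous_on_sgn A_cont) (use A_nz in auto)
    show "continuous_on {0..1} (\<lambda>t. cross3 (V t) (sgn (A t)))"
      by (intro continuous_on_cross V_cont a)
    show "sgn (A 1) = sgn (A 0)" by (simp add: A_def V1)
    then show "cross3 (V 1) (sgn (A 1)) = - cross3 (V 0) (sgn (A 0))" by (simp add: V1 cross_minus_left)
    fix t :: real assume t: "t \<in> {0..1}"
    have na: "norm (sgn (A t)) = 1" using A_nz by (simp add: norm_sgn)
    have oa: "sgn (A t) \<bullet> V t = 0" using AV[OF t] by (simp add: sgn_div_norm)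
    have "orthonormal_frame (V t) (sgn (A t)) (cross3 (V t) (sgn (A t)))"
      using norm_V[OF t] na oa by (intro cross3_frame) (simp_all add: inner_commute)
    then show "orthonormal_frame (sgn (A t)) (cross3 (V t) (sgn (A t))) (sgn (g t))"
      unfolding orthonormal_frame_def V_def[symmetric] by (metis inner_commute)
  qed
qed

text \<open>
  Over an antipodal path inside \<open>\<bar>h\<bar> < \<delta>\<close> the flags are parametrized by the angle \<open>\<phi>\<close> of \<open>u\<close> in
  the frame along the path. Reversing \<open>u\<close> is the half turn in \<open>\<phi>\<close>, and the ends are glued by a reflection.
\<close>
lemma equivariant_flag_map_approximate_zero:
  fixes h :: "real^3 \<Rightarrow> real" and F :: "real^3 \<Rightarrow> real^3 \<Rightarrow> complex"
  assumes h_cont: "continuous_on S2 h" and h_odd: "\<And>v. v \<in> S2 \<Longrightarrow> h (- v) = - h v" and "\<delta> > 0"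
    and F_cont: "continuous_on {(u, v) \<in> flags. \<bar>h v\<bar> < \<delta>} (\<lambda>(u, v). F u v)"
    and F_u: "\<And>u v. (u, v) \<in> flags \<Longrightarrow> F (- u) v = cnj (F u v)"
    and F_v: "\<And>u v. (u, v) \<in> flags \<Longrightarrow> F u (- v) = - cnj (F u v)"
  shows "\<exists>u v. (u, v) \<in> flags \<and> \<bar>h v\<bar> < \<delta> \<and> F u v = 0"
proof -
  have dim3: "3 \<le> DIM(real^3)" by simp
  have "continuous_on (- {0}) (\<lambda>x. h (sgn x))"
    by (rule continuous_on_compose2[OF h_cont]) (auto simp: norm_sgn intro!: continuous_on_sgn split: if_splits)
  moreover have "h (sgn (- x)) = - h (sgn x)" if "x \<noteq> 0" for x
    using that h_odd[of "sgn x"] by (simp add: sgn_minus norm_sgn)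
  ultimately obtain g :: "real \<Rightarrow> real^3" where g: "polynomial_function g" "g 1 = - g 0"
    and g': "\<And>t. t \<in> {0..1} \<Longrightarrow> g t \<noteq> 0 \<and> \<bar>h (sgn (g t))\<bar> < \<delta>"
    using antipodal_polynomial_path[of "\<lambda>x. h (sgn x)" \<delta>, OF dim3] \<open>\<delta> > 0\<close> by metis
  obtain a b where ab: "continuous_on {0..1} a" "continuous_on {0..1} b"
    "\<And>t. t \<in> {0..1} \<Longrightarrow> orthonormal_frame (a t) (b t) (sgn (g t))"
    "a 1 = a 0" "b 1 = - b 0"
    using frame_along_polynomial_path[OF g] g' by metis
  define V where "V t = sgn (g t)" for t
  define U where "U t \<phi> = cos \<phi> *\<^sub>R a t + sin \<phi> *\<^sub>R b t" for t \<phi>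
  have UV: "(U t \<phi>, V t) \<in> flags" if "t \<in> {0..1}" for t \<phi>
  proof -
    note o = frame_inner[OF ab(3)[OF that], folded V_def]
    have "U t \<phi> \<bullet> U t \<phi> = (cos \<phi>)\<^sup>2 + (sin \<phi>)\<^sup>2"
      by (simp add: U_def inner_add_left inner_add_right o power2_eq_square)
    then have "norm (U t \<phi>) = 1" by (simp add: norm_eq_1)
    moreover have "U t \<phi> \<bullet> V t = 0" by (simp add: U_def inner_add_left o)
    ultimately show ?thesis using o(3) by (simp add: flags_iff norm_eq_1)
  qed
  have g_cont: "continuous_on {0..1} V"
    unfolding V_def using g'
    by (intro continuous_on_sgn continuous_on_polymonial_function[OF g(1)]) auto
  have "continuous_on ({0..1} \<times> UNIV) (\<lambda>x. (U (fst x) (snd x), V (fst x)))"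
    unfolding U_def
    by (intro continuous_intros continuous_on_compose2[OF ab(1)] continuous_on_compose2[OF ab(2)]
        continuous_on_compose2[OF g_cont]) auto
  then have "continuous_on ({0..1} \<times> UNIV) (\<lambda>x. (\<lambda>(u, v). F u v) (U (fst x) (snd x), V (fst x)))"
    by (rule continuous_on_compose2[OF F_cont]) (use UV g' in \<open>auto simp: V_def\<close>)
  then have cont: "continuous_on ({0..1} \<times> UNIV) (\<lambda>(t, \<phi>). F (U t \<phi>) (V t))"
    by (simp add: case_prod_unfold)
  have "\<exists>t\<in>{0..1}. \<exists>\<phi>. F (U t \<phi>) (V t) = 0"
  proof (rule conjugation_equivariant_map_has_zero[OF cont])
    fix t \<phi> :: real assume t: "t \<in> {0..1}"
    have "U t (\<phi> + pi) = - U t \<phi>" by (simp add: U_def)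
    then show "F (U t (\<phi> + pi)) (V t) = cnj (F (U t \<phi>) (V t))" using F_u[OF UV[OF t]] by simp
  next
    fix \<phi> :: real
    have "U 1 (- \<phi>) = U 0 \<phi>" "V 1 = - V 0" by (simp_all add: U_def V_def ab(4,5) g(2) sgn_minus)
    then show "F (U 1 (- \<phi>)) (V 1) = - cnj (F (U 0 \<phi>) (V 0))" using F_v[OF UV[of 0 \<phi>]] by simp
  qed
  then obtain t \<phi> where t: "t \<in> {0..1}" and z: "F (U t \<phi>) (V t) = 0" by blast
  have "\<bar>h (V t)\<bar> < \<delta>" using g'[OF t] by (simp add: V_def)
  with UV[OF t] z show ?thesis by metis
qed

text \<open>
  On the compact set of zeros of \<open>F\<close> with \<open>\<bar>h\<bar> \<le> \<delta>\<close>, the minimum of \<open>\<bar>h\<bar>\<close> must be \<open>0\<close>,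
  since approximate zeros exist below every positive bound. Continuity of \<open>F\<close> is required only near
  \<open>h = 0\<close>: where the hemisphere around \<open>v\<close> is too light, the swept angle below does not exist.
\<close>
lemma equivariant_flag_map_zero:
  fixes h :: "real^3 \<Rightarrow> real" and F :: "real^3 \<Rightarrow> real^3 \<Rightarrow> complex"
  assumes h_cont: "continuous_on S2 h" and h_odd: "\<And>v. v \<in> S2 \<Longrightarrow> h (- v) = - h v" and "\<delta> > 0"
    and F_cont: "continuous_on {(u, v) \<in> flags. \<bar>h v\<bar> \<le> \<delta>} (\<lambda>(u, v). F u v)"
    and F_u: "\<And>u v. (u, v) \<in> flags \<Longrightarrow> F (- u) v = cnj (F u v)"
    and F_v: "\<And>u v. (u, v) \<in> flags \<Longrightarrow> F u (- v) = - cnj (F u v)"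
  shows "\<exists>u v. (u, v) \<in> flags \<and> h v = 0 \<and> F u v = 0"
proof -
  let ?N = "{(u, v) \<in> flags. \<bar>h v\<bar> \<le> \<delta>}"
  let ?Z = "?N \<inter> (\<lambda>(u, v). F u v) -` {0}"
  have approx: "\<exists>u v. (u, v) \<in> flags \<and> \<bar>h v\<bar> < \<epsilon> \<and> F u v = 0" if "0 < \<epsilon>" "\<epsilon> \<le> \<delta>" for \<epsilon>
  proof (rule equivariant_flag_map_approximate_zero[OF h_cont h_odd that(1)])
    show "continuous_on {(u, v) \<in> flags. \<bar>h v\<bar> < \<epsilon>} (\<lambda>(u, v). F u v)"
      by (rule continuous_on_subset[OF F_cont]) (use that in auto)
  qed (use F_u F_v in auto)
  have h_flags: "continuous_on flags (\<lambda>x. \<bar>h (snd x)\<bar>)"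
    by (intro continuous_intros continuous_on_compose2[OF h_cont]) (auto simp: flags_def)
  have "closed (flags \<inter> (\<lambda>x. \<bar>h (snd x)\<bar>) -` {..\<delta>})"
    by (rule continuous_closed_preimage[OF h_flags compact_imp_closed[OF compact_flags]]) simp
  moreover have N_eq: "?N = flags \<inter> (\<lambda>x. \<bar>h (snd x)\<bar>) -` {..\<delta>}" by auto
  ultimately have "closed ?N" by simp
  then have "closed ?Z" by (rule continuous_closed_preimage[OF F_cont]) simp
  then have "compact (flags \<inter> ?Z)" by (rule compact_Int_closed[OF compact_flags])
  moreover have "flags \<inter> ?Z = ?Z" by auto
  ultimately have "compact ?Z" by simp
  moreover have "?Z \<noteq> {}" using approx[of \<delta>] \<open>\<delta> > 0\<close> by force
  moreover have "continuous_on ?Z (\<lambda>x. \<bar>h (snd x)\<bar>)" by (rule continuous_on_subset[OF h_flags]) auto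
  ultimately obtain x where x: "x \<in> ?Z" "\<forall>y\<in>?Z. \<bar>h (snd x)\<bar> \<le> \<bar>h (snd y)\<bar>"
    using continuous_attains_inf[of ?Z "\<lambda>x. \<bar>h (snd x)\<bar>"] by blast
  have "h (snd x) = 0"
  proof (rule ccontr)
    assume "h (snd x) \<noteq> 0"
    then obtain u v where uv: "(u, v) \<in> flags" "\<bar>h v\<bar> < \<bar>h (snd x)\<bar>" "F u v = 0"
      using approx[of "\<bar>h (snd x)\<bar>"] x(1) by auto
    then have "(u, v) \<in> ?Z" using x(1) by auto
    with uv(2) bspec[OF x(2) this] show False by simp
  qed
  with x(1) show ?thesis
    by (intro exI[of _ "fst x"] exI[of _ "snd x"]) (auto simp: case_prod_unfold)
qed

section \<open>Angular sectors and fans of planes\<close>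

lemma polar_coordinates:
  fixes X Y s :: real
  obtains r \<phi> where "0 \<le> r" "s \<le> \<phi>" "\<phi> < s + 2 * pi" "X = r * cos \<phi>" "Y = r * sin \<phi>"
proof -
  define z where "z = Complex X Y * cis (- s)"
  obtain t where t: "z = rcis (cmod z) t" "0 \<le> t" "t < 2 * pi"
  proof -
    define t where "t = (if Arg z < 0 then Arg z + 2 * pi else Arg z)"
    have "cis t = cis (Arg z)" by (simp add: t_def complex_eq_iff)
    then have "z = rcis (cmod z) t" by (metis rcis_cmod_Arg rcis_def)
    moreover have "0 \<le> t" "t < 2 * pi" using Arg_bounded[of z] by (auto simp: t_def)
    ultimately show thesis using that by blast
  qed
  have "Complex X Y = z * cis s" by (simp add: z_def mult.assoc cis_mult)
  also have "\<dots> = rcis (cmod z) (t + s)" by (subst t(1)) (simp add: rcis_def mult.assoc cis_mult)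
  finally have "X = cmod z * cos (t + s)" "Y = cmod z * sin (t + s)"
    by (auto simp: complex_eq_iff)
  then show thesis using t by (intro that[of "cmod z" "t + s"]) auto
qed

text \<open>
  The normal of the plane that contains the axis and the direction of angle \<open>\<theta>\<close>, pointing to the side of
  increasing angles.
\<close>
definition edge_normal :: "real^3 \<Rightarrow> real^3 \<Rightarrow> real \<Rightarrow> real^3" where
  "edge_normal u v \<theta> = cos \<theta> *\<^sub>R v - sin \<theta> *\<^sub>R u"

definition lune :: "real^3 \<Rightarrow> real^3 \<Rightarrow> (real^3) set" where
  "lune a b = {y \<in> S2. 0 < a \<bullet> y \<and> 0 < b \<bullet> y}"

lemma edge_normal_simps: "edge_normal u v 0 = v" "edge_normal u v pi = - v" "edge_normal u v (2 * pi) = v"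
  by (simp_all add: edge_normal_def)

lemma edge_normal_dot_polar:
  assumes "orthonormal_frame u v w"
  shows "edge_normal u v \<theta> \<bullet> (r *\<^sub>R (cos \<phi> *\<^sub>R u + sin \<phi> *\<^sub>R v) + z *\<^sub>R w) = r * sin (\<phi> - \<theta>)"
  by (simp add: edge_normal_def inner_add_right inner_diff_left frame_inner[OF assms] sin_diff algebra_simps)

lemma frame_polar:
  assumes f: "orthonormal_frame u v w"
  obtains r \<phi> where "0 \<le> r" "s \<le> \<phi>" "\<phi> < s + 2 * pi"
    "x = r *\<^sub>R (cos \<phi> *\<^sub>R u + sin \<phi> *\<^sub>R v) + (x \<bullet> w) *\<^sub>R w"
proof -
  obtain r \<phi> where r: "0 \<le> r" "s \<le> \<phi>" "\<phi> < s + 2 * pi" "x \<bullet> u = r * cos \<phi>" "x \<bullet> v = r * sin \<phi>"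
    using polar_coordinates[of s "x \<bullet> u" "x \<bullet> v"] by blast
  show thesis
  proof (rule that[OF r(1-3)])
    show "x = r *\<^sub>R (cos \<phi> *\<^sub>R u + sin \<phi> *\<^sub>R v) + (x \<bullet> w) *\<^sub>R w"
      using frame_expansion[OF f, of x] unfolding r(4,5) by (simp add: scaleR_add_right)
  qed
qed

lemma sin_sign_cases:
  assumes "0 < sin x" "0 \<le> x" "x < 2 * pi"
  shows "0 < x \<and> x < pi"
proof
  show "0 < x" using assms by (cases "x = 0") auto
  show "x < pi" using assms sin_le_zero[of x] by linarith
qed

text \<open>
  A sector is cut out by its two bounding planes as long as its angle does not exceed \<open>\<pi>\<close>. Lunes depend on
  two normals only, which makes openness and continuity in the flag accessible.
\<close>
lemma angular_sector_eq_lune: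
  assumes f: "orthonormal_frame u v w" and st: "s < t" "t \<le> s + pi"
  shows "angular_sector u v w s t = lune (edge_normal u v s) (- edge_normal u v t)"
proof (intro set_eqI iffI)
  fix x assume "x \<in> angular_sector u v w s t"
  then obtain r \<phi> z where x: "x \<in> S2" "0 < r" "s < \<phi>" "\<phi> < t"
    "x = r *\<^sub>R (cos \<phi> *\<^sub>R u + sin \<phi> *\<^sub>R v) + z *\<^sub>R w" by (auto simp: angular_sector_def)
  have "0 < sin (\<phi> - s)" "0 < sin (t - \<phi>)" using x st by (auto intro!: sin_gt_zero)
  moreover have "sin (\<phi> - t) = - sin (t - \<phi>)" by (metis minus_diff_eq sin_minus)
  ultimately show "x \<in> lune (edge_normal u v s) (- edge_normal u v t)"
    using x(1,2) unfolding lune_def by (simp add: x(5) edge_normal_dot_polar[OF f])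
next
  fix x assume x: "x \<in> lune (edge_normal u v s) (- edge_normal u v t)"
  obtain r \<phi> where r: "0 \<le> r" "s \<le> \<phi>" "\<phi> < s + 2 * pi"
    "x = r *\<^sub>R (cos \<phi> *\<^sub>R u + sin \<phi> *\<^sub>R v) + (x \<bullet> w) *\<^sub>R w" using frame_polar[OF f] by metis
  have "edge_normal u v s \<bullet> x = r * sin (\<phi> - s)" "edge_normal u v t \<bullet> x = r * sin (\<phi> - t)"
    by (subst r(4), rule edge_normal_dot_polar[OF f])+
  with x have 1: "0 < r * sin (\<phi> - s)" "r * sin (\<phi> - t) < 0" "x \<in> S2" by (auto simp: lune_def)
  then have "0 < r" using r(1) by (cases "r = 0") auto
  with 1 have 2: "0 < sin (\<phi> - s)" "sin (\<phi> - t) < 0"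
    by (auto simp: zero_less_mult_iff mult_less_0_iff)
  then have "0 < \<phi> - s \<and> \<phi> - s < pi" using r by (intro sin_sign_cases) auto
  moreover have "\<phi> < t"
  proof (rule ccontr)
    assume "\<not> \<phi> < t"
    then have "0 \<le> sin (\<phi> - t)" using calculation st by (intro sin_ge_zero) auto
    with 2 show False by simp
  qed
  ultimately show "x \<in> angular_sector u v w s t"
    using \<open>0 < r\<close> r(4) 1(3) unfolding angular_sector_def by auto
qed

lemma openin_lune: "openin (top_of_set S2) (lune a b)"
proof -
  have "open {y. 0 < a \<bullet> y \<and> 0 < b \<bullet> y}"
    by (intro open_Collect_conj open_Collect_less continuous_intros)
  moreover have "lune a b = S2 \<inter> {y. 0 < a \<bullet> y \<and> 0 < b \<bullet> y}" by (auto simp: lune_def)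
  ultimately show ?thesis by (simp add: openin_open_Int)
qed

lemma angular_sector_eq_image:
  assumes f: "orthonormal_frame u v w"
  shows "angular_sector u v w s t =
    (\<lambda>(\<phi>, z). sqrt (1 - z\<^sup>2) *\<^sub>R (cos \<phi> *\<^sub>R u + sin \<phi> *\<^sub>R v) + z *\<^sub>R w) ` ({s<..<t} \<times> {-1<..<1})"
proof -
  have n: "norm (r *\<^sub>R (cos \<phi> *\<^sub>R u + sin \<phi> *\<^sub>R v) + z *\<^sub>R w) = 1 \<longleftrightarrow> r\<^sup>2 + z\<^sup>2 = 1" for r \<phi> z
  proof -
    have "(r *\<^sub>R (cos \<phi> *\<^sub>R u + sin \<phi> *\<^sub>R v) + z *\<^sub>R w) \<bullet> (r *\<^sub>R (cos \<phi> *\<^sub>R u + sin \<phi> *\<^sub>R v) + z *\<^sub>R w)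
      = r\<^sup>2 * ((cos \<phi>)\<^sup>2 + (sin \<phi>)\<^sup>2) + z\<^sup>2"
      by (simp add: inner_add_left inner_add_right frame_inner[OF f] power2_eq_square distrib_left mult.assoc
          del: sin_cos_squared_add sin_cos_squared_add2 sin_cos_squared_add3)
    then show ?thesis by (simp add: norm_eq_1)
  qed
  have r_eq: "r = sqrt (1 - z\<^sup>2) \<and> -1 < z \<and> z < 1" if "r\<^sup>2 + z\<^sup>2 = 1" "0 < r" for r z :: real
  proof -
    have "z\<^sup>2 < 1" using that zero_less_power[of r 2] by linarith
    then have "\<bar>z\<bar> < 1" by (simp add: abs_square_less_1)
    moreover have "r = sqrt (1 - z\<^sup>2)" using that by (intro real_sqrt_unique[symmetric]) auto
    ultimately show ?thesis by auto
  qed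
  have z_pos: "0 < sqrt (1 - z\<^sup>2) \<and> (sqrt (1 - z\<^sup>2))\<^sup>2 + z\<^sup>2 = 1" if "-1 < z" "z < 1" for z :: real
  proof -
    have "z\<^sup>2 < 1" using that by (simp add: abs_square_less_1)
    then show ?thesis by simp
  qed
  show ?thesis
  proof (intro set_eqI iffI)
    fix x assume "x \<in> angular_sector u v w s t"
    then obtain r \<phi> z where x: "norm x = 1" "0 < r" "s < \<phi>" "\<phi> < t"
      "x = r *\<^sub>R (cos \<phi> *\<^sub>R u + sin \<phi> *\<^sub>R v) + z *\<^sub>R w" by (auto simp: angular_sector_def)
    then have "r = sqrt (1 - z\<^sup>2) \<and> -1 < z \<and> z < 1" using n r_eq by blast
    with x show "x \<in> (\<lambda>(\<phi>, z). sqrt (1 - z\<^sup>2) *\<^sub>R (cos \<phi> *\<^sub>R u + sin \<phi> *\<^sub>R v) + z *\<^sub>R w) ` ({s<..<t} \<times> {-1<..<1})"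
      by (intro image_eqI[of _ _ "(\<phi>, z)"]) auto
  next
    fix x assume "x \<in> (\<lambda>(\<phi>, z). sqrt (1 - z\<^sup>2) *\<^sub>R (cos \<phi> *\<^sub>R u + sin \<phi> *\<^sub>R v) + z *\<^sub>R w) ` ({s<..<t} \<times> {-1<..<1})"
    then obtain \<phi> z where x: "s < \<phi>" "\<phi> < t" "-1 < z" "z < 1"
      "x = sqrt (1 - z\<^sup>2) *\<^sub>R (cos \<phi> *\<^sub>R u + sin \<phi> *\<^sub>R v) + z *\<^sub>R w" by auto
    then have "norm x = 1" using n z_pos[OF x(3,4)] by simp
    with x z_pos[OF x(3,4)] show "x \<in> angular_sector u v w s t"
      unfolding angular_sector_def
      by (intro CollectI conjI exI[of _ "sqrt (1 - z\<^sup>2)"] exI[of _ \<phi>] exI[of _ z]) auto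
  qed
qed

lemma connected_angular_sector:
  assumes "orthonormal_frame u v w"
  shows "connected (angular_sector u v w s t)"
  unfolding angular_sector_eq_image[OF assms]
  by (intro connected_continuous_image convex_connected convex_Times)
    (auto simp: case_prod_unfold intro!: continuous_intros)

lemma angular_sector_nonempty:
  assumes "orthonormal_frame u v w" "s < t"
  shows "angular_sector u v w s t \<noteq> {}"
  unfolding angular_sector_eq_image[OF assms(1)] using assms(2) by simp

text \<open>
  Two angles of the same point differ by a multiple of \<open>2\<pi>\<close>, and no nonzero multiple is small enough here.
\<close>
lemma angular_sectors_disjoint:
  assumes f: "orthonormal_frame u v w" and "t \<le> s'" "t' \<le> s + 2 * pi"
  shows "angular_sector u v w s t \<inter> angular_sector u v w s' t' = {}"
proof (rule ccontr)
  assume "\<not> ?thesis"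
  then obtain r \<phi> z r' \<phi>' z' where x: "0 < r" "s < \<phi>" "\<phi> < t" "0 < r'" "s' < \<phi>'" "\<phi>' < t'"
    and eq: "r *\<^sub>R (cos \<phi> *\<^sub>R u + sin \<phi> *\<^sub>R v) + z *\<^sub>R w = r' *\<^sub>R (cos \<phi>' *\<^sub>R u + sin \<phi>' *\<^sub>R v) + z' *\<^sub>R w"
    by (auto simp: angular_sector_def)
  have "edge_normal u v (\<phi> - pi / 2) \<bullet> (r *\<^sub>R (cos \<phi> *\<^sub>R u + sin \<phi> *\<^sub>R v) + z *\<^sub>R w) = r"
    "edge_normal u v \<phi> \<bullet> (r *\<^sub>R (cos \<phi> *\<^sub>R u + sin \<phi> *\<^sub>R v) + z *\<^sub>R w) = 0"
    by (simp_all add: edge_normal_dot_polar[OF f])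
  then have "r' * sin (\<phi>' - (\<phi> - pi / 2)) = r" and 0: "r' * sin (\<phi>' - \<phi>) = 0"
    unfolding eq edge_normal_dot_polar[OF f] by simp_all
  moreover have "sin (\<phi>' - (\<phi> - pi / 2)) = cos (\<phi>' - \<phi>)"
    using sin_add[of "\<phi>' - \<phi>" "pi / 2"] by (simp add: algebra_simps)
  ultimately have 1: "r' * cos (\<phi>' - \<phi>) = r" by simp
  have "sin (\<phi>' - \<phi>) = 0" using 0 x by simp
  moreover have "0 < cos (\<phi>' - \<phi>)" using 1 x by (metis zero_less_mult_pos)
  ultimately have "cos (\<phi>' - \<phi>) = 1" using sin_zero_abs_cos_one by fastforce
  then obtain n :: int where n: "\<phi>' - \<phi> = of_int n * (2 * pi)" unfolding cos_one_2pi_int by (auto simp: algebra_simps)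
  have "0 < \<phi>' - \<phi>" "\<phi>' - \<phi> < 2 * pi" using x assms by auto
  then have "0 < of_int n * (2 * pi)" "of_int n * (2 * pi) < 1 * (2 * pi)" unfolding n by auto
  then have "0 < n" "n < 1" by (auto simp: zero_less_mult_iff mult_less_cancel_right)
  then show False by simp
qed

lemma angular_sector_shift: "angular_sector u v w (s + 2 * pi) (t + 2 * pi) = angular_sector u v w s t"
proof -
  have "(\<exists>r \<phi> z. 0 < r \<and> s + 2 * pi < \<phi> \<and> \<phi> < t + 2 * pi \<and> x = r *\<^sub>R (cos \<phi> *\<^sub>R u + sin \<phi> *\<^sub>R v) + z *\<^sub>R w)
    \<longleftrightarrow> (\<exists>r \<phi> z. 0 < r \<and> s < \<phi> \<and> \<phi> < t \<and> x = r *\<^sub>R (cos \<phi> *\<^sub>R u + sin \<phi> *\<^sub>R v) + z *\<^sub>R w)" for x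
  proof
    assume "\<exists>r \<phi> z. 0 < r \<and> s + 2 * pi < \<phi> \<and> \<phi> < t + 2 * pi \<and> x = r *\<^sub>R (cos \<phi> *\<^sub>R u + sin \<phi> *\<^sub>R v) + z *\<^sub>R w"
    then obtain r \<phi> z where *: "0 < r" "s + 2 * pi < \<phi>" "\<phi> < t + 2 * pi" "x = r *\<^sub>R (cos \<phi> *\<^sub>R u + sin \<phi> *\<^sub>R v) + z *\<^sub>R w" by blast
    show "\<exists>r \<phi> z. 0 < r \<and> s < \<phi> \<and> \<phi> < t \<and> x = r *\<^sub>R (cos \<phi> *\<^sub>R u + sin \<phi> *\<^sub>R v) + z *\<^sub>R w"
      by (rule exI[of _ r], rule exI[of _ "\<phi> - 2 * pi"], rule exI[of _ z])
        (use * in \<open>simp add: cos_diff sin_diff\<close>)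
  next
    assume "\<exists>r \<phi> z. 0 < r \<and> s < \<phi> \<and> \<phi> < t \<and> x = r *\<^sub>R (cos \<phi> *\<^sub>R u + sin \<phi> *\<^sub>R v) + z *\<^sub>R w"
    then obtain r \<phi> z where *: "0 < r" "s < \<phi>" "\<phi> < t" "x = r *\<^sub>R (cos \<phi> *\<^sub>R u + sin \<phi> *\<^sub>R v) + z *\<^sub>R w" by blast
    show "\<exists>r \<phi> z. 0 < r \<and> s + 2 * pi < \<phi> \<and> \<phi> < t + 2 * pi \<and> x = r *\<^sub>R (cos \<phi> *\<^sub>R u + sin \<phi> *\<^sub>R v) + z *\<^sub>R w"
      by (rule exI[of _ r], rule exI[of _ "\<phi> + 2 * pi"], rule exI[of _ z])
        (use * in simp)
  qed
  then show ?thesis by (simp add: angular_sector_def)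
qed

text \<open>Each block is relatively clopen, its complement being a union of blocks, so no connected set can exceed it.\<close>
lemma components_eq_open_partition:
  assumes conn: "\<And>C. C \<in> \<C> \<Longrightarrow> connected C \<and> C \<noteq> {}"
    and op: "\<And>C. C \<in> \<C> \<Longrightarrow> openin (top_of_set S) C"
    and disj: "disjoint \<C>" and un: "\<Union>\<C> = S"
  shows "components S = \<C>"
proof -
  have comp: "C \<in> components S" if C: "C \<in> \<C>" for C
    unfolding in_components_maximal
  proof (intro conjI allI impI)
    show "C \<noteq> {}" "connected C" using conn[OF C] by auto
    show "C \<subseteq> S" using un C by auto
    fix D assume D: "D \<noteq> {} \<and> C \<subseteq> D \<and> D \<subseteq> S \<and> connected D"
    have eq: "C = S - \<Union>(\<C> - {C})"
      using un C disjointD[OF disj C] by blast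
    have "openin (top_of_set S) (\<Union>(\<C> - {C}))" using op by blast
    then have "closedin (top_of_set S) C" by (subst eq) (simp add: closedin_diff)
    then have "closedin (top_of_set D) C" using D by (meson closedin_subset_trans)
    moreover have "openin (top_of_set D) C" using op[OF C] D by (meson openin_subset_trans)
    ultimately show "D = C" using D conn[OF C] connected_clopen[of D] by blast
  qed
  show ?thesis
  proof
    show "\<C> \<subseteq> components S" using comp by blast
    show "components S \<subseteq> \<C>"
    proof
      fix K assume K: "K \<in> components S"
      then obtain x where x: "x \<in> K" "x \<in> S"
        using in_components_nonempty in_components_subset by blast
      then obtain C where C: "C \<in> \<C>" "x \<in> C" using un by blast
      then have "K = C" using components_nonoverlap[OF K comp[OF C(1)]] x by blast
      with C show "K \<in> \<C>" by simp
    qed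
  qed
qed

definition plane_at :: "real^3 \<Rightarrow> real^3 \<Rightarrow> real \<Rightarrow> (real^3) set" where
  "plane_at u v \<theta> = {x. edge_normal u v \<theta> \<bullet> x = 0}"

lemma edge_normal_frame_dots:
  assumes "orthonormal_frame u v w"
  shows "edge_normal u v \<theta> \<bullet> w = 0" "edge_normal u v \<theta> \<bullet> (cos \<phi> *\<^sub>R u + sin \<phi> *\<^sub>R v) = sin (\<phi> - \<theta>)"
  using edge_normal_dot_polar[OF assms, of \<theta> 0 0 1] edge_normal_dot_polar[OF assms, of \<theta> 1 \<phi> 0]
  by simp_all

lemma edge_normal_nonzero:
  assumes "orthonormal_frame u v w"
  shows "edge_normal u v \<theta> \<noteq> 0"
  using edge_normal_frame_dots(2)[OF assms, of \<theta> "\<theta> + pi / 2"] by auto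

lemma plane_at_is_plane:
  assumes "orthonormal_frame u v w"
  shows "plane_through_origin (plane_at u v \<theta>)"
  unfolding plane_through_origin_def plane_at_def
  using edge_normal_nonzero[OF assms] by (simp add: subspace_hyperplane dim_hyperplane)

lemma plane_at_distinct:
  assumes f: "orthonormal_frame u v w" and "s < t" "t < s + pi"
  shows "plane_at u v s \<noteq> plane_at u v t"
proof -
  have "0 < sin (t - s)" using assms by (intro sin_gt_zero) auto
  moreover have "sin (s - t) = - sin (t - s)" by (metis minus_diff_eq sin_minus)
  ultimately have "cos s *\<^sub>R u + sin s *\<^sub>R v \<notin> plane_at u v t" "cos s *\<^sub>R u + sin s *\<^sub>R v \<in> plane_at u v s"
    by (simp_all add: plane_at_def edge_normal_frame_dots[OF f])
  then show ?thesis by blast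
qed

lemma plane_at_Int:
  assumes f: "orthonormal_frame u v w" and "s < t" "t < s + pi"
  shows "plane_at u v s \<inter> plane_at u v t = span {w}"
proof (intro set_eqI iffI)
  fix x assume x: "x \<in> plane_at u v s \<inter> plane_at u v t"
  have "0 < sin (t - s)" using assms by (intro sin_gt_zero) auto
  define X Y where "X = u \<bullet> x" and "Y = v \<bullet> x"
  have e: "cos s * Y = sin s * X" "cos t * Y = sin t * X"
    using x by (simp_all add: plane_at_def edge_normal_def inner_diff_left X_def Y_def)
  have "sin (t - s) * X = cos s * (sin t * X) - cos t * (sin s * X)" by (simp add: sin_diff algebra_simps)
  also have "\<dots> = 0" unfolding e[symmetric] by (simp add: algebra_simps)
  finally have X: "X = 0" using \<open>0 < sin (t - s)\<close> by simp
  have "sin (t - s) * Y = sin t * (cos s * Y) - sin s * (cos t * Y)" by (simp add: sin_diff algebra_simps)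
  also have "\<dots> = 0" unfolding e by (simp add: algebra_simps)
  finally have Y: "Y = 0" using \<open>0 < sin (t - s)\<close> by simp
  have "x = (x \<bullet> w) *\<^sub>R w"
    using frame_expansion[OF f, of x] X Y by (simp add: X_def Y_def inner_commute)
  then show "x \<in> span {w}" by (auto simp: span_singleton)
next
  fix x assume "x \<in> span {w}"
  then show "x \<in> plane_at u v s \<inter> plane_at u v t"
    by (auto simp: span_singleton plane_at_def edge_normal_frame_dots(1)[OF f])
qed

lemma fan_position_plane_at:
  assumes f: "orthonormal_frame u v w" and t: "\<theta>0 < \<theta>1" "\<theta>1 < \<theta>2" "\<theta>2 < \<theta>0 + pi"
  shows "fan_position (plane_at u v \<theta>0) (plane_at u v \<theta>1) (plane_at u v \<theta>2)"
proof -
  have "span {w} \<subseteq> plane_at u v \<theta>2"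
    using plane_at_Int[OF f, of \<theta>1 \<theta>2] t by auto
  then have "plane_at u v \<theta>0 \<inter> plane_at u v \<theta>1 \<inter> plane_at u v \<theta>2 = span {w}"
    using plane_at_Int[OF f, of \<theta>0 \<theta>1] t by auto
  moreover have "w \<noteq> 0" using frame_inner(3)[OF f] by auto
  then have "dim (span {w}) = 1" by (simp add: dim_insert)
  ultimately show ?thesis
    unfolding fan_position_def using plane_at_is_plane[OF f] plane_at_distinct[OF f] t by auto
qed

lemma sin_nonzero:
  assumes "- pi < x" "x < 2 * pi" "x \<noteq> 0" "x \<noteq> pi"
  shows "sin x \<noteq> 0"
proof -
  consider "0 < - x \<and> - x < pi" | "0 < x \<and> x < pi" | "0 < x - pi \<and> x - pi < pi" using assms by linarith
  then show ?thesis
    using sin_gt_zero[of "- x"] sin_gt_zero[of x] sin_gt_zero[of "x - pi"] by cases auto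
qed

text \<open>
  The six angles \<open>\<tau>\<close> at which the planes are met divide the circle. A point on one of the planes is one where some
  \<open>sin (\<phi> - \<theta>)\<close> vanishes, so the complement of the planes is the union of the six sectors, which are
  connected, relatively open and disjoint.
\<close>
lemma fan_cyclic_sectors:
  assumes f: "orthonormal_frame u v w" and t: "\<theta>0 < \<theta>1" "\<theta>1 < \<theta>2" "\<theta>2 < \<theta>0 + pi"
  shows "cyclic_sectors (plane_at u v \<theta>0) (plane_at u v \<theta>1) (plane_at u v \<theta>2)
    [angular_sector u v w \<theta>0 \<theta>1, angular_sector u v w \<theta>1 \<theta>2, angular_sector u v w \<theta>2 (\<theta>0 + pi),
     angular_sector u v w (\<theta>0 + pi) (\<theta>1 + pi), angular_sector u v w (\<theta>1 + pi) (\<theta>2 + pi),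
     angular_sector u v w (\<theta>2 + pi) (\<theta>0 + 2 * pi)]"
proof -
  define \<tau> where "\<tau> = (!) [\<theta>0, \<theta>1, \<theta>2, \<theta>0 + pi, \<theta>1 + pi, \<theta>2 + pi, \<theta>0 + 2 * pi]"
  define sec where "sec i = angular_sector u v w (\<tau> i) (\<tau> (Suc i))" for i
  let ?P = "plane_at u v \<theta>0 \<union> plane_at u v \<theta>1 \<union> plane_at u v \<theta>2"
  have six: "i < 6 \<longleftrightarrow> i = 0 \<or> i = Suc 0 \<or> i = 2 \<or> i = 3 \<or> i = 4 \<or> i = 5" for i :: nat by auto
  have tau: "\<tau> 0 = \<theta>0" "\<tau> (Suc 0) = \<theta>1" "\<tau> 2 = \<theta>2" "\<tau> 3 = \<theta>0 + pi" "\<tau> 4 = \<theta>1 + pi" "\<tau> 5 = \<theta>2 + pi"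
    "\<tau> 6 = \<theta>0 + 2 * pi" "\<tau> (Suc (Suc 0)) = \<theta>2" by (simp_all add: \<tau>_def)
  have tau_step: "\<tau> i < \<tau> (Suc i) \<and> \<tau> (Suc i) < \<tau> i + pi" if "i < 6" for i
    using that t unfolding six by (elim disjE) (simp_all add: tau)
  have mono: "\<tau> i \<le> \<tau> j" if "i \<le> j" "j \<le> 6" for i j
    using that
  proof (induction j rule: dec_induct)
    case (step n)
    then show ?case using tau_step[of n] by simp
  qed simp
  have disj: "sec i \<inter> sec j = {}" if "i < j" "j < 6" for i j
    unfolding sec_def using that mono[of "Suc i" j] mono[of "Suc j" 6] mono[of 0 i]
    by (intro angular_sectors_disjoint[OF f]) (auto simp: tau)
  have ne: "sec i \<noteq> {}" if "i < 6" for i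
    unfolding sec_def by (rule angular_sector_nonempty[OF f conjunct1[OF tau_step[OF that]]])
  have inj: "sec i \<noteq> sec j" if "i < j" "j < 6" for i j
    using disj[OF that] ne[OF that(2)] by auto
  let ?\<sigma> = "map sec [0..<6]"
  have list: "?\<sigma> = [angular_sector u v w \<theta>0 \<theta>1, angular_sector u v w \<theta>1 \<theta>2, angular_sector u v w \<theta>2 (\<theta>0 + pi),
     angular_sector u v w (\<theta>0 + pi) (\<theta>1 + pi), angular_sector u v w (\<theta>1 + pi) (\<theta>2 + pi),
     angular_sector u v w (\<theta>2 + pi) (\<theta>0 + 2 * pi)]"
    by (simp add: sec_def \<tau>_def upt_rec)
  have dist: "distinct ?\<sigma>"
  proof -
    have "inj_on sec {0..<6}"
      by (rule linorder_inj_onI) (use inj in auto)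
    then show ?thesis by (simp add: distinct_map)
  qed
  have avoid: "x \<notin> ?P" if "i < 6" "x \<in> sec i" for i x
  proof -
    obtain r \<phi> z where x: "0 < r" "\<tau> i < \<phi>" "\<phi> < \<tau> (Suc i)"
      "x = r *\<^sub>R (cos \<phi> *\<^sub>R u + sin \<phi> *\<^sub>R v) + z *\<^sub>R w" using \<open>x \<in> sec i\<close> by (auto simp: sec_def angular_sector_def)
    have "edge_normal u v \<theta> \<bullet> x \<noteq> 0" if "\<theta> \<in> {\<theta>0, \<theta>1, \<theta>2}" for \<theta>
    proof -
      have "- pi < \<phi> - \<theta> \<and> \<phi> - \<theta> < 2 * pi \<and> \<phi> - \<theta> \<noteq> 0 \<and> \<phi> - \<theta> \<noteq> pi"
        using that x(2,3) \<open>i < 6\<close> t unfolding six by (elim disjE insertE) (simp_all add: tau)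
      then have "sin (\<phi> - \<theta>) \<noteq> 0" by (intro sin_nonzero) auto
      then show ?thesis unfolding x(4) edge_normal_dot_polar[OF f] using x(1) by simp
    qed
    then show ?thesis by (auto simp: plane_at_def)
  qed
  have cover: "\<exists>i<6. x \<in> sec i" if "x \<in> S2" "x \<notin> ?P" for x
  proof -
    obtain r \<phi> where r: "0 \<le> r" "\<theta>0 \<le> \<phi>" "\<phi> < \<theta>0 + 2 * pi"
      "x = r *\<^sub>R (cos \<phi> *\<^sub>R u + sin \<phi> *\<^sub>R v) + (x \<bullet> w) *\<^sub>R w" using frame_polar[OF f] by metis
    have dot: "edge_normal u v \<theta> \<bullet> x = r * sin (\<phi> - \<theta>)" for \<theta>
      by (subst r(4), rule edge_normal_dot_polar[OF f])
    have nz: "r * sin (\<phi> - \<theta>) \<noteq> 0" if "\<theta> \<in> {\<theta>0, \<theta>1, \<theta>2}" for \<theta>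
      using \<open>x \<notin> ?P\<close> that by (auto simp: plane_at_def dot)
    then have "0 < r" using r(1) by (cases "r = 0") auto
    have "sin (\<phi> - \<theta>) \<noteq> 0" if "\<theta> \<in> {\<theta>0, \<theta>1, \<theta>2}" for \<theta> using nz[OF that] by auto
    then have "\<phi> - \<theta> \<noteq> 0" "\<phi> - \<theta> \<noteq> pi" if "\<theta> \<in> {\<theta>0, \<theta>1, \<theta>2}" for \<theta>
      using that sin_zero sin_pi by metis+
    then have "\<phi> \<noteq> \<theta>0" "\<phi> \<noteq> \<theta>1" "\<phi> \<noteq> \<theta>2" "\<phi> \<noteq> \<theta>0 + pi" "\<phi> \<noteq> \<theta>1 + pi" "\<phi> \<noteq> \<theta>2 + pi"
      by force+
    then consider "\<theta>0 < \<phi> \<and> \<phi> < \<theta>1" | "\<theta>1 < \<phi> \<and> \<phi> < \<theta>2" | "\<theta>2 < \<phi> \<and> \<phi> < \<theta>0 + pi"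
      | "\<theta>0 + pi < \<phi> \<and> \<phi> < \<theta>1 + pi" | "\<theta>1 + pi < \<phi> \<and> \<phi> < \<theta>2 + pi" | "\<theta>2 + pi < \<phi>"
      using r(2) by (metis antisym_conv3 order_le_less)
    then have "\<tau> 0 < \<phi> \<and> \<phi> < \<tau> (Suc 0) \<or> \<tau> 1 < \<phi> \<and> \<phi> < \<tau> (Suc 1) \<or> \<tau> 2 < \<phi> \<and> \<phi> < \<tau> (Suc 2)
      \<or> \<tau> 3 < \<phi> \<and> \<phi> < \<tau> (Suc 3) \<or> \<tau> 4 < \<phi> \<and> \<phi> < \<tau> (Suc 4) \<or> \<tau> 5 < \<phi> \<and> \<phi> < \<tau> (Suc 5)"
      using r(3) by cases (simp_all add: tau)
    then have "\<exists>i<6. \<tau> i < \<phi> \<and> \<phi> < \<tau> (Suc i)" unfolding six by (metis One_nat_def)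
    with \<open>0 < r\<close> r(4) \<open>x \<in> S2\<close> show ?thesis unfolding sec_def angular_sector_def by blast
  qed
  have set: "set ?\<sigma> = sec ` {..<6}" by (simp only: set_map set_upt atLeast0LessThan)
  have "components (S2 - ?P) = sec ` {..<6}"
  proof (rule components_eq_open_partition)
    show un: "\<Union>(sec ` {..<6}) = S2 - ?P"
    proof
      have "sec i \<subseteq> S2" for i by (auto simp: sec_def angular_sector_def)
      then show "\<Union>(sec ` {..<6}) \<subseteq> S2 - ?P" using avoid by blast
      show "S2 - ?P \<subseteq> \<Union>(sec ` {..<6})" using cover by blast
    qed
    fix C assume "C \<in> sec ` {..<6}"
    then obtain i where i: "i < 6" "C = sec i" by auto
    show "connected C \<and> C \<noteq> {}"
      using ne[OF i(1)] i(2) connected_angular_sector[OF f] by (simp add: sec_def)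
    have "openin (top_of_set S2) (sec i)"
      unfolding sec_def
      by (subst angular_sector_eq_lune[OF f]) (use tau_step[OF i(1)] in \<open>auto simp: openin_lune\<close>)
    moreover have "sec i \<subseteq> S2 - ?P" using un i(1) by blast
    ultimately show "openin (top_of_set (S2 - ?P)) C"
      unfolding i(2) by (rule openin_subset_trans) blast
  next
    show "disjoint (sec ` {..<6})"
    proof (rule disjointI)
      fix A B assume "A \<in> sec ` {..<6}" "B \<in> sec ` {..<6}" "A \<noteq> B"
      then obtain i j where "i < 6" "j < 6" "A = sec i" "B = sec j" "i \<noteq> j" by auto
      then show "A \<inter> B = {}" using disj[of i j] disj[of j i] by (cases "i < j") auto
    qed
  qed
  moreover have "w \<in> plane_at u v \<theta>" for \<theta> by (simp add: plane_at_def edge_normal_frame_dots(1)[OF f])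
  ultimately show ?thesis
    unfolding list[symmetric] cyclic_sectors_def set
    using f dist tau_step tau(1,7) by (intro conjI exI[of _ u] exI[of _ v] exI[of _ w] exI[of _ \<tau>]) (auto simp: sec_def)
qed

section \<open>Sweeping a fixed mass from a half-plane\<close>

locale sphere_measure = prob_space \<mu> for \<mu> :: "(real^3) measure" +
  assumes proper: "proper_borel_measure \<mu>"
begin

lemma sets_\<mu>: "sets \<mu> = sets (restrict_space borel S2)"
  using proper by (simp add: proper_borel_measure_def)

lemma space_\<mu>: "space \<mu> = S2"
  using sets_eq_imp_space_eq[OF sets_\<mu>] by (simp add: space_restrict_space)

lemma borel_in_sets: "A \<in> sets borel \<Longrightarrow> A \<subseteq> S2 \<Longrightarrow> A \<in> sets \<mu>"
  unfolding sets_\<mu> by (auto simp: sets_restrict_space)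

lemma lune_sets [measurable]: "lune a b \<in> sets \<mu>"
proof (rule borel_in_sets)
  have "open {y. 0 < a \<bullet> y \<and> 0 < b \<bullet> y}"
    by (intro open_Collect_conj open_Collect_less continuous_intros)
  moreover have "lune a b = S2 \<inter> {y. 0 < a \<bullet> y \<and> 0 < b \<bullet> y}" by (auto simp: lune_def)
  ultimately show "lune a b \<in> sets borel" by simp
qed (auto simp: lune_def)

lemma circular_arc_null:
  assumes "circular_arc A"
  shows "A \<in> null_sets \<mu>"
proof -
  obtain u v t where *: "norm u = 1" "norm v = 1" "u \<bullet> v = 0"
    "A = (\<lambda>\<phi>. cos \<phi> *\<^sub>R u + sin \<phi> *\<^sub>R v) ` {0..t}"
    using assms unfolding circular_arc_def by blast
  have "compact A" unfolding *(4) by (intro compact_continuous_image continuous_intros) auto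
  moreover have "A \<subseteq> S2"
  proof -
    have "(cos \<phi> *\<^sub>R u + sin \<phi> *\<^sub>R v) \<bullet> (cos \<phi> *\<^sub>R u + sin \<phi> *\<^sub>R v) = 1" for \<phi>
      using * sin_cos_squared_add3[of \<phi>]
      by (simp add: inner_add_left inner_add_right inner_commute norm_eq_1)
    then show ?thesis unfolding *(4) by (auto simp: norm_eq_1)
  qed
  ultimately have "A \<in> sets \<mu>" by (intro borel_in_sets borel_closed compact_imp_closed)
  moreover have "emeasure \<mu> A = 0" using proper assms unfolding proper_borel_measure_def by blast
  ultimately show ?thesis by auto
qed

text \<open>An arc has length less than \<open>2\<pi>\<close>, so a great circle is covered by two half circles.\<close>
lemma great_circle_null:
  assumes "a \<noteq> 0"
  shows "{y \<in> S2. a \<bullet> y = 0} \<in> null_sets \<mu>"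
proof -
  define w where "w = sgn a"
  have w: "norm w = 1" "w \<bullet> y = 0 \<longleftrightarrow> a \<bullet> y = 0" for y
    using assms by (auto simp: w_def norm_sgn sgn_div_norm)
  have "\<exists>x. x \<noteq> 0 \<and> orthogonal w x"
    by (rule orthogonal_to_vector_exists[of w]) (auto simp: orthogonal_def)
  then obtain u0 where u0: "u0 \<noteq> 0" "orthogonal w u0" by blast
  define u where "u = sgn u0"
  have u: "norm u = 1" "w \<bullet> u = 0" using u0 by (auto simp: u_def norm_sgn sgn_div_norm orthogonal_def)
  define v where "v = cross3 w u"
  have "orthonormal_frame w u v" unfolding v_def by (intro cross3_frame w u)
  then have f: "orthonormal_frame u v w" by (auto simp: orthonormal_frame_def inner_commute)
  note fi = frame_inner[OF f]
  define half where "half s = (\<lambda>\<phi>. cos \<phi> *\<^sub>R u + sin \<phi> *\<^sub>R (s *\<^sub>R v)) ` {0..pi}" for s :: real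
  have "circular_arc (half s)" if "\<bar>s\<bar> = 1" for s
    unfolding circular_arc_def half_def
    by (rule exI[of _ u], rule exI[of _ "s *\<^sub>R v"], rule exI[of _ pi]) (use that fi in \<open>auto simp: norm_eq_1\<close>)
  then have "half 1 \<union> half (-1) \<in> null_sets \<mu>" by (intro null_sets.Un circular_arc_null) auto
  moreover have "{y \<in> S2. a \<bullet> y = 0} \<subseteq> half 1 \<union> half (-1)"
  proof
    fix y assume "y \<in> {y \<in> S2. a \<bullet> y = 0}"
    then have y: "norm y = 1" "y \<bullet> w = 0" using w(2)[of y] by (auto simp: inner_commute)
    have ex: "y = (y \<bullet> u) *\<^sub>R u + (y \<bullet> v) *\<^sub>R v" using frame_expansion[OF f, of y] y(2) by simp
    have "y \<bullet> y = ((y \<bullet> u) *\<^sub>R u + (y \<bullet> v) *\<^sub>R v) \<bullet> y" by (rule arg_cong[OF ex])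
    also have "\<dots> = (y \<bullet> u) * (y \<bullet> u) + (y \<bullet> v) * (y \<bullet> v)"
      by (simp add: inner_add_left inner_add_right inner_commute)
    finally have sq: "(y \<bullet> u)\<^sup>2 + (y \<bullet> v)\<^sup>2 = 1" using y(1) by (simp add: norm_eq_1 power2_eq_square)
    show "y \<in> half 1 \<union> half (-1)"
    proof (cases "0 \<le> y \<bullet> v")
      case True
      obtain t where t: "0 \<le> t" "t \<le> pi" "y \<bullet> u = cos t" "y \<bullet> v = sin t"
        using sincos_total_pi[OF True sq] by blast
      have "y = cos t *\<^sub>R u + sin t *\<^sub>R (1 *\<^sub>R v)" using ex t by simp
      then show ?thesis using t unfolding half_def by auto
    next
      case False
      then obtain t where t: "0 \<le> t" "t \<le> pi" "y \<bullet> u = cos t" "- (y \<bullet> v) = sin t"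
        using sincos_total_pi[of "- (y \<bullet> v)" "y \<bullet> u"] sq by auto
      have "sin t *\<^sub>R ((-1) *\<^sub>R v) = (y \<bullet> v) *\<^sub>R v" unfolding t(4)[symmetric] by simp
      then have "y = cos t *\<^sub>R u + sin t *\<^sub>R ((-1) *\<^sub>R v)" using ex t(3) by simp
      then show ?thesis using t unfolding half_def by auto
    qed
  qed
  moreover have "{y \<in> S2. a \<bullet> y = 0} \<in> sets \<mu>"
  proof (rule borel_in_sets)
    have "closed {y. a \<bullet> y = 0}" by (rule closed_hyperplane)
    moreover have "{y \<in> S2. a \<bullet> y = 0} = S2 \<inter> {y. a \<bullet> y = 0}" by auto
    ultimately show "{y \<in> S2. a \<bullet> y = 0} \<in> sets borel" by simp
  qed auto
  ultimately show ?thesis using null_sets_subset by blast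
qed

text \<open>
  The indicator of a lune converges pointwise at every point off the two limiting great circles, which are null;
  dominated convergence does the rest. The degenerate pairs \<open>b = -a\<close> and \<open>b = a\<close> are included, so a lune may open
  continuously from the empty set to a hemisphere.
\<close>
lemma continuous_measure_lune:
  "continuous_on ((- {0}) \<times> (- {0})) (\<lambda>(a, b). measure \<mu> (lune a b))"
  unfolding continuous_on_sequentially
proof (intro allI ballI impI, elim conjE)
  fix x :: "nat \<Rightarrow> (real^3) \<times> (real^3)" and p
  assume p: "p \<in> (- {0}) \<times> (- {0})" and lim: "x \<longlonglongrightarrow> p"
  define a b where "a = fst p" and "b = snd p"
  have ab: "a \<noteq> 0" "b \<noteq> 0" using p by (auto simp: a_def b_def)
  have la: "(\<lambda>n. fst (x n)) \<longlonglongrightarrow> a" and lb: "(\<lambda>n. snd (x n)) \<longlonglongrightarrow> b"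
    unfolding a_def b_def using lim by (auto intro: tendsto_intros)
  let ?I = "\<lambda>a b. indicator (lune a b) :: real^3 \<Rightarrow> real"
  have null: "{y \<in> S2. a \<bullet> y = 0} \<union> {y \<in> S2. b \<bullet> y = 0} \<in> null_sets \<mu>"
    using ab by (intro null_sets.Un great_circle_null)
  have "AE y in \<mu>. y \<notin> {y \<in> S2. a \<bullet> y = 0} \<union> {y \<in> S2. b \<bullet> y = 0}"
    using null by (rule AE_not_in)
  then have ae: "AE y in \<mu>. a \<bullet> y \<noteq> 0 \<and> b \<bullet> y \<noteq> 0"
    using AE_space by eventually_elim (auto simp: space_\<mu>)
  have sgn_ev: "\<forall>\<^sub>F n in sequentially. (0 < c n \<bullet> y) = (0 < d \<bullet> y)"
    if "c \<longlonglongrightarrow> d" "d \<bullet> y \<noteq> 0" for c and d y :: "real^3"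
  proof -
    have l: "(\<lambda>n. c n \<bullet> y) \<longlonglongrightarrow> d \<bullet> y" by (intro tendsto_intros that)
    show ?thesis
    proof (cases "0 < d \<bullet> y")
      case True
      show ?thesis by (rule eventually_mono[OF order_tendstoD(1)[OF l True]]) (use True in simp)
    next
      case False
      then have neg: "d \<bullet> y < 0" using that by simp
      show ?thesis by (rule eventually_mono[OF order_tendstoD(2)[OF l neg]]) (use neg in simp)
    qed
  qed
  have "(\<lambda>n. integral\<^sup>L \<mu> (?I (fst (x n)) (snd (x n)))) \<longlonglongrightarrow> integral\<^sup>L \<mu> (?I a b)"
  proof (rule integral_dominated_convergence[where w = "\<lambda>_. 1"])
    show "AE y in \<mu>. (\<lambda>n. ?I (fst (x n)) (snd (x n)) y) \<longlonglongrightarrow> ?I a b y"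
      using ae
    proof eventually_elim
      fix y assume y: "a \<bullet> y \<noteq> 0 \<and> b \<bullet> y \<noteq> 0"
      have "\<forall>\<^sub>F n in sequentially. ?I (fst (x n)) (snd (x n)) y = ?I a b y"
        using sgn_ev[OF la conjunct1[OF y]] sgn_ev[OF lb conjunct2[OF y]]
        by eventually_elim (simp add: indicator_def lune_def)
      then show "(\<lambda>n. ?I (fst (x n)) (snd (x n)) y) \<longlonglongrightarrow> ?I a b y" by (rule tendsto_eventually)
    qed
  qed (auto simp: indicator_def)
  moreover have "integral\<^sup>L \<mu> (?I c d) = measure \<mu> (lune c d)" for c d
    using sets.sets_into_space[OF lune_sets] by (simp add: Int_absorb2)
  ultimately show "((\<lambda>(a, b). measure \<mu> (lune a b)) \<circ> x) \<longlonglongrightarrow> (case p of (a, b) \<Rightarrow> measure \<mu> (lune a b))"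
    by (simp add: o_def case_prod_unfold a_def b_def)
qed

text \<open>Additivity for a set that is cut in two by a plane: the part of the set on the plane is null.\<close>
lemma measure_disjoint_cover:
  assumes "A \<in> sets \<mu>" "B \<in> sets \<mu>" "C \<in> sets \<mu>" "A \<inter> B = {}" "A \<union> B \<subseteq> C"
    and n: "n \<noteq> 0" "C \<subseteq> A \<union> B \<union> {y \<in> S2. n \<bullet> y = 0}"
  shows "measure \<mu> C = measure \<mu> A + measure \<mu> B"
proof -
  have "measure \<mu> (A \<union> B) = measure \<mu> C"
  proof (rule finite_measure_eq_AE)
    have "AE y in \<mu>. y \<notin> {y \<in> S2. n \<bullet> y = 0}" by (rule AE_not_in[OF great_circle_null[OF n(1)]])
    then show "AE y in \<mu>. (y \<in> A \<union> B) = (y \<in> C)" by eventually_elim (use assms in blast)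
  qed (use assms in auto)
  then show ?thesis using assms finite_measure_Union[of A B] by simp
qed

lemma hemisphere_complement:
  assumes "a \<noteq> 0"
  shows "measure \<mu> (lune a a) + measure \<mu> (lune (- a) (- a)) = 1"
proof -
  have "measure \<mu> (space \<mu>) = measure \<mu> (lune a a) + measure \<mu> (lune (- a) (- a))"
    by (rule measure_disjoint_cover[OF lune_sets lune_sets sets.top _ _ assms]) (auto simp: lune_def space_\<mu>)
  then show ?thesis by (simp add: prob_space)
qed

lemma angular_sector_sets:
  assumes f: "orthonormal_frame u v w" and "s < t" "t \<le> s + pi"
  shows "angular_sector u v w s t \<in> sets \<mu>"
  using assms by (simp add: angular_sector_eq_lune)

lemma angular_sector_pos:
  assumes f: "orthonormal_frame u v w" and "s < t" "t \<le> s + pi"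
  shows "0 < measure \<mu> (angular_sector u v w s t)"
proof -
  have "openin (top_of_set S2) (angular_sector u v w s t)"
    using assms by (simp add: angular_sector_eq_lune openin_lune)
  then have "0 < emeasure \<mu> (angular_sector u v w s t)"
    using proper angular_sector_nonempty[OF f \<open>s < t\<close>] by (auto simp: proper_borel_measure_def)
  then show ?thesis by (simp add: emeasure_eq_measure)
qed

lemma angular_sector_add:
  assumes f: "orthonormal_frame u v w" and st: "s < t" "t < r" "r \<le> s + pi"
  shows "measure \<mu> (angular_sector u v w s r) =
    measure \<mu> (angular_sector u v w s t) + measure \<mu> (angular_sector u v w t r)"
proof (rule measure_disjoint_cover[OF _ _ _ _ _ edge_normal_nonzero[OF f, of t]])
  show "angular_sector u v w s t \<in> sets \<mu>" "angular_sector u v w t r \<in> sets \<mu>"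
    "angular_sector u v w s r \<in> sets \<mu>" using st by (auto intro!: angular_sector_sets[OF f])
  show "angular_sector u v w s t \<inter> angular_sector u v w t r = {}"
    using st by (intro angular_sectors_disjoint[OF f]) auto
  have "angular_sector u v w s' t' \<subseteq> angular_sector u v w s r" if "s \<le> s'" "t' \<le> r" for s' t'
    unfolding angular_sector_def using that by (auto intro: order_le_less_trans order_less_le_trans)
  then show "angular_sector u v w s t \<union> angular_sector u v w t r \<subseteq> angular_sector u v w s r"
    using st by simp
  show "angular_sector u v w s r \<subseteq> angular_sector u v w s t \<union> angular_sector u v w t r
    \<union> {y \<in> S2. edge_normal u v t \<bullet> y = 0}"
  proof
    fix x assume "x \<in> angular_sector u v w s r"
    then obtain q \<phi> z where x: "x \<in> S2" "0 < q" "s < \<phi>" "\<phi> < r"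
      "x = q *\<^sub>R (cos \<phi> *\<^sub>R u + sin \<phi> *\<^sub>R v) + z *\<^sub>R w" unfolding angular_sector_def by blast
    consider "\<phi> < t" | "\<phi> = t" | "t < \<phi>" by linarith
    then show "x \<in> angular_sector u v w s t \<union> angular_sector u v w t r
      \<union> {y \<in> S2. edge_normal u v t \<bullet> y = 0}"
    proof cases
      case 1
      with x show ?thesis unfolding angular_sector_def by blast
    next
      case 2
      then have "edge_normal u v t \<bullet> x = 0" unfolding x(5) edge_normal_dot_polar[OF f] by simp
      with x(1) show ?thesis by blast
    next
      case 3
      with x show ?thesis unfolding angular_sector_def by blast
    qed
  qed
qed

lemma swept_lune_eq:
  assumes "(u, v) \<in> flags" "0 < x" "x \<le> pi"
  shows "lune v (- edge_normal u v x) = angular_sector u v (cross3 u v) 0 x"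
  using angular_sector_eq_lune[OF cross3_frame, of u v 0 x] assms by (simp add: flags_iff edge_normal_simps)

text \<open>
  The increment is the measure of a nonempty open sector. At angle \<open>0\<close> the lune is empty and there is no sector to
  add to, hence the case distinction.
\<close>
lemma swept_strict_mono:
  assumes uv: "(u, v) \<in> flags" and x: "0 \<le> x" "x < x'" "x' \<le> pi"
  shows "measure \<mu> (lune v (- edge_normal u v x)) < measure \<mu> (lune v (- edge_normal u v x'))"
proof -
  have f: "orthonormal_frame u v (cross3 u v)" using uv by (intro cross3_frame) (auto simp: flags_iff)
  show ?thesis
  proof (cases "x = 0")
    case True
    then have "lune v (- edge_normal u v x) = {}" by (auto simp: lune_def edge_normal_simps)
    then show ?thesis using swept_lune_eq[OF uv, of x'] angular_sector_pos[OF f, of 0 x'] x True by simp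
  next
    case False
    then show ?thesis
      using swept_lune_eq[OF uv, of x] swept_lune_eq[OF uv, of x'] x
        angular_sector_add[OF f, of 0 x x'] angular_sector_pos[OF f, of x x'] by simp
  qed
qed

text \<open>The angle through which the half-plane at \<open>u\<close> must turn towards \<open>v\<close> in order to sweep mass \<open>p\<close>.\<close>
definition swept_angle :: "real \<Rightarrow> real^3 \<Rightarrow> real^3 \<Rightarrow> real" where
  "swept_angle p u v = (THE x. x \<in> {0..pi} \<and> measure \<mu> (lune v (- edge_normal u v x)) = p)"

lemma continuous_swept:
  "continuous_on (flags \<times> UNIV) (\<lambda>((u, v), x). measure \<mu> (lune v (- edge_normal u v x)))"
proof -
  have "continuous_on (flags \<times> (UNIV :: real set)) (\<lambda>q. (\<lambda>(a, b). measure \<mu> (lune a b))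
      (snd (fst q), - edge_normal (fst (fst q)) (snd (fst q)) (snd q)))"
  proof (rule continuous_on_compose2[OF continuous_measure_lune])
    show "continuous_on (flags \<times> UNIV) (\<lambda>q::((real^3) \<times> (real^3)) \<times> real.
        (snd (fst q), - edge_normal (fst (fst q)) (snd (fst q)) (snd q)))"
      unfolding edge_normal_def by (intro continuous_intros)
    show "(\<lambda>q::((real^3) \<times> (real^3)) \<times> real. (snd (fst q), - edge_normal (fst (fst q)) (snd (fst q)) (snd q)))
      ` (flags \<times> UNIV) \<subseteq> (- {0}) \<times> (- {0})"
    proof (rule image_subsetI)
      fix q :: "((real^3) \<times> (real^3)) \<times> real"
      assume "q \<in> flags \<times> UNIV"
      then have "norm (fst (fst q)) = 1 \<and> norm (snd (fst q)) = 1 \<and> fst (fst q) \<bullet> snd (fst q) = 0"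
        by (auto simp: flags_def)
      then have "orthonormal_frame (fst (fst q)) (snd (fst q)) (cross3 (fst (fst q)) (snd (fst q)))"
        "snd (fst q) \<noteq> 0" by (auto intro: cross3_frame)
      then show "(snd (fst q), - edge_normal (fst (fst q)) (snd (fst q)) (snd q)) \<in> (- {0}) \<times> (- {0})"
        using edge_normal_nonzero by simp
    qed
  qed
  then show ?thesis by (simp add: case_prod_unfold)
qed

lemma swept_angle_unique:
  assumes uv: "(u, v) \<in> flags" and x: "x \<in> {0..pi}" "measure \<mu> (lune v (- edge_normal u v x)) = p"
  shows "swept_angle p u v = x"
  unfolding swept_angle_def
proof (rule the_equality)
  fix y assume y: "y \<in> {0..pi} \<and> measure \<mu> (lune v (- edge_normal u v y)) = p"
  then show "y = x"
    using swept_strict_mono[OF uv, of x y] swept_strict_mono[OF uv, of y x] x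
    by (cases x y rule: linorder_cases) auto
qed (use x in simp)

lemma swept_angle:
  assumes uv: "(u, v) \<in> flags" and p: "0 < p" "p < measure \<mu> (lune v v)"
  shows "0 < swept_angle p u v" "swept_angle p u v < pi"
    "measure \<mu> (lune v (- edge_normal u v (swept_angle p u v))) = p"
proof -
  let ?L = "\<lambda>x. measure \<mu> (lune v (- edge_normal u v x))"
  have "lune v (- edge_normal u v 0) = {}" by (auto simp: lune_def edge_normal_simps)
  then have L: "?L 0 = 0" "?L pi = measure \<mu> (lune v v)" by (simp_all add: edge_normal_simps)
  have "continuous_on {0..pi} (\<lambda>x. (\<lambda>((u, v), x). measure \<mu> (lune v (- edge_normal u v x))) ((u, v), x))"
    by (rule continuous_on_compose2[OF continuous_swept]) (use uv in \<open>auto intro!: continuous_intros\<close>)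
  then have "continuous_on {0..pi} ?L" by simp
  then obtain x where x: "0 \<le> x" "x \<le> pi" "?L x = p"
    using IVT'[of ?L 0 p pi] L p by auto
  then have eq: "swept_angle p u v = x" using swept_angle_unique[OF uv] by auto
  show "?L (swept_angle p u v) = p" using x eq by simp
  have "x \<noteq> 0" "x \<noteq> pi" using x(3) L p by auto
  with x eq show "0 < swept_angle p u v" "swept_angle p u v < pi" by auto
qed

text \<open>
  The graph is a level set of a jointly continuous function, hence closed, and the angles lie in a compact interval.
\<close>
lemma continuous_swept_angle:
  assumes p: "0 < p" and N: "N \<subseteq> flags" "\<And>u v. (u, v) \<in> N \<Longrightarrow> p < measure \<mu> (lune v v)"
  shows "continuous_on N (\<lambda>(u, v). swept_angle p u v)"
proof -
  let ?f = "\<lambda>(u, v). swept_angle p u v" and ?L = "\<lambda>((u, v), x). measure \<mu> (lune v (- edge_normal u v x))"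
  have "continuous_on N ?f \<longleftrightarrow> closedin (top_of_set (N \<times> {0..pi})) ((\<lambda>x. (x, ?f x)) ` N)"
  proof (rule continuous_closed_graph_eq)
    show "?f \<in> N \<rightarrow> {0..pi}"
    proof (rule Pi_I)
      fix q assume q: "q \<in> N"
      obtain u v where uv: "q = (u, v)" by (cases q)
      with q N(1) have "(u, v) \<in> flags" by blast
      from swept_angle(1,2)[OF this p N(2)[OF q[unfolded uv]]] uv show "?f q \<in> {0..pi}" by simp
    qed
  qed simp
  moreover have "(\<lambda>x. (x, ?f x)) ` N = (N \<times> {0..pi}) \<inter> ?L -` {p}"
  proof (intro set_eqI iffI)
    fix q assume "q \<in> (\<lambda>x. (x, ?f x)) ` N"
    then obtain u v where uv: "(u, v) \<in> N" "q = ((u, v), swept_angle p u v)" by auto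
    with N(1) have "(u, v) \<in> flags" by blast
    from swept_angle[OF this p N(2)[OF uv(1)]] uv show "q \<in> (N \<times> {0..pi}) \<inter> ?L -` {p}" by simp
  next
    fix q assume "q \<in> (N \<times> {0..pi}) \<inter> ?L -` {p}"
    then obtain u v x where q: "q = ((u, v), x)" "(u, v) \<in> N" "x \<in> {0..pi}"
      "measure \<mu> (lune v (- edge_normal u v x)) = p" by auto
    with N(1) have "swept_angle p u v = x" by (intro swept_angle_unique) auto
    with q show "q \<in> (\<lambda>x. (x, ?f x)) ` N" by (intro image_eqI[of _ _ "(u, v)"]) auto
  qed
  moreover have "closedin (top_of_set (N \<times> {0..pi})) ((N \<times> {0..pi}) \<inter> ?L -` {p})"
    by (rule continuous_closedin_preimage[OF continuous_on_subset[OF continuous_swept]]) (use N(1) in auto)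
  ultimately show ?thesis by simp
qed

text \<open>
  At a common zero of \<open>h\<close> and \<open>F\<close>, with \<open>u\<close> at angle \<open>0\<close>, the four equations for the swept angles say that the
  sectors \<open>(-c, 0)\<close>, \<open>(0, a)\<close>, \<open>(\<pi> - c, \<pi>)\<close> and \<open>(\<pi>, \<pi> + a)\<close> have measure \<open>p\<close>. The
  bound \<open>p < 1/4\<close> serves twice: it leaves room between \<open>a\<close> and \<open>\<pi> - c\<close> in a half of the sphere, and
  it makes hemispheres with \<open>\<bar>h\<bar> \<le> 1/4\<close> heavy enough for the swept angle to be defined.
\<close>
lemma balanced_fan:
  assumes p: "0 < p" "p < 1 / 4"
  obtains u v w a c where "orthonormal_frame u v w" "0 < a" "0 < c" "a + c < pi"
    "measure \<mu> (angular_sector u v w (- c) 0) = p"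
    "measure \<mu> (angular_sector u v w 0 a) = p"
    "measure \<mu> (angular_sector u v w a (pi - c)) = 1 / 2 - 2 * p"
    "measure \<mu> (angular_sector u v w (pi - c) pi) = p"
    "measure \<mu> (angular_sector u v w pi (pi + a)) = p"
    "measure \<mu> (angular_sector u v w (pi + a) (2 * pi - c)) = 1 / 2 - 2 * p"
proof -
  define h where "h v = measure \<mu> (lune v v) - 1 / 2" for v
  define A where "A = swept_angle p"
  define F where "F u v = Complex ((A (- u) (- v) - A u v) + (A u (- v) - A (- u) v))
    ((A (- u) (- v) - A u v) - (A u (- v) - A (- u) v))" for u v
  let ?N = "{(u, v) \<in> flags. \<bar>h v\<bar> \<le> 1 / 4}"
  have h_odd: "h (- v) = - h v" if "v \<in> S2" for v
  proof -
    have "v \<noteq> 0" using that by auto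
    then show ?thesis using hemisphere_complement[of v] by (simp add: h_def)
  qed
  have flags_sign: "(- u, v) \<in> flags" "(u, - v) \<in> flags" if "(u, v) \<in> flags" for u v
    using that by (auto simp: flags_iff)
  have "continuous_on S2 (\<lambda>v. (\<lambda>(a, b). measure \<mu> (lune a b)) (v, v))"
    by (rule continuous_on_compose2[OF continuous_measure_lune]) (auto intro!: continuous_intros)
  then have h_cont: "continuous_on S2 h" unfolding h_def by (auto intro!: continuous_intros)
  have large: "p < measure \<mu> (lune v v)" if "\<bar>h v\<bar> \<le> 1 / 4" for v
    using that p(2) unfolding h_def by linarith
  have "continuous_on ?N (\<lambda>(u, v). A u v)"
    unfolding A_def by (rule continuous_swept_angle[OF p(1)]) (use large in auto)
  then have A_cont: "continuous_on ?N (\<lambda>q. A (fst q) (snd q))" by (simp add: case_prod_unfold)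
  have sign_cont: "continuous_on ?N (\<lambda>q. A (s *\<^sub>R fst q) (t *\<^sub>R snd q))"
    if "s = 1 \<or> s = - 1" "t = 1 \<or> t = - 1" for s t
  proof -
    have "continuous_on ?N (\<lambda>q. A (fst (s *\<^sub>R fst q, t *\<^sub>R snd q)) (snd (s *\<^sub>R fst q, t *\<^sub>R snd q)))"
    proof (rule continuous_on_compose2[OF A_cont])
      show "(\<lambda>q. (s *\<^sub>R fst q, t *\<^sub>R snd q)) ` ?N \<subseteq> ?N"
        using that h_odd by (auto simp: flags_def)
    qed (intro continuous_intros)
    then show ?thesis by simp
  qed
  have "continuous_on ?N (\<lambda>q. F (fst q) (snd q))"
    unfolding F_def Complex_eq
    using sign_cont[of 1 1] sign_cont[of 1 "-1"] sign_cont[of "-1" 1] sign_cont[of "-1" "-1"]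
    by (auto intro!: continuous_intros)
  then have F_cont: "continuous_on ?N (\<lambda>(u, v). F u v)" by (simp add: case_prod_unfold)
  have "\<exists>u v. (u, v) \<in> flags \<and> h v = 0 \<and> F u v = 0"
    by (rule equivariant_flag_map_zero[OF h_cont h_odd _ F_cont]) (auto simp: F_def complex_eq_iff)
  then obtain u v where uv: "(u, v) \<in> flags" "h v = 0" "F u v = 0" by blast
  define w where "w = cross3 u v"
  have f: "orthonormal_frame u v w" using uv(1) unfolding w_def by (intro cross3_frame) (auto simp: flags_iff)
  define a c where "a = A u v" and "c = A u (- v)"
  have ac: "A (- u) (- v) = a" "A (- u) v = c"
    using uv(3) by (auto simp: F_def complex_eq_iff a_def c_def)
  have half: "measure \<mu> (lune v v) = 1 / 2" "measure \<mu> (lune (- v) (- v)) = 1 / 2"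
    using uv h_odd[of v] by (auto simp: h_def flags_iff)
  have p1: "p < measure \<mu> (lune v v)" "p < measure \<mu> (lune (- v) (- v))" using half p by auto
  note S = swept_angle[OF _ p(1), folded A_def]
  have a: "0 < a" "a < pi" and c: "0 < c" "c < pi"
    using S(1,2)[OF uv(1) p1(1)] S(1,2)[OF flags_sign(2)[OF uv(1)] p1(2)] by (simp_all add: a_def c_def)
  have 1: "measure \<mu> (lune v (- edge_normal u v a)) = p"
    "measure \<mu> (lune (- v) (- edge_normal (- u) (- v) a)) = p"
    "measure \<mu> (lune (- v) (- edge_normal u (- v) c)) = p"
    "measure \<mu> (lune v (- edge_normal (- u) v c)) = p"
    using S(3)[OF uv(1) p1(1)] S(3)[OF flags_sign(1)[OF flags_sign(2)[OF uv(1)]] p1(2)]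
      S(3)[OF flags_sign(2)[OF uv(1)] p1(2)] S(3)[OF flags_sign(1)[OF uv(1)] p1(1)]
    by (simp_all add: ac flip: a_def c_def)
  have N: "- edge_normal (- u) (- v) a = - edge_normal u v (pi + a)"
      "- edge_normal u (- v) c = edge_normal u v (- c)"
      "- edge_normal (- u) v c = edge_normal u v (pi - c)"
    by (simp_all add: edge_normal_def)
  have lune_commute: "lune x y = lune y x" for x y by (auto simp: lune_def)
  note lune_eq = angular_sector_eq_lune[OF f] and q = 1[unfolded N]
  have m: "measure \<mu> (angular_sector u v w 0 a) = p"
      "measure \<mu> (angular_sector u v w pi (pi + a)) = p"
      "measure \<mu> (angular_sector u v w (- c) 0) = p"
      "measure \<mu> (angular_sector u v w (pi - c) pi) = p"
      "measure \<mu> (angular_sector u v w 0 pi) = 1 / 2"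
      "measure \<mu> (angular_sector u v w pi (2 * pi)) = 1 / 2"
    using q(1) lune_eq[of 0 a] q(2) lune_eq[of pi "pi + a"]
      q(3) lune_eq[of "- c" 0] lune_commute[of "- v" "edge_normal u v (- c)"]
      q(4) lune_eq[of "pi - c" pi] lune_commute[of v "edge_normal u v (pi - c)"]
      half lune_eq[of 0 pi] lune_eq[of pi "2 * pi"] a c
    unfolding edge_normal_simps minus_minus by auto
  have m': "measure \<mu> (angular_sector u v w (2 * pi - c) (2 * pi)) = p"
    using m(3) angular_sector_shift[of u v w "- c" 0] by (simp add: add.commute)
  have m0: "measure \<mu> (angular_sector u v w 0 (pi - c)) = 1 / 2 - p"
    using angular_sector_add[OF f, of 0 "pi - c" pi] m c by simp
  have lt: "a < pi - c"
  proof (rule ccontr)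
    assume "\<not> a < pi - c"
    then have "measure \<mu> (angular_sector u v w 0 (pi - c)) \<le> measure \<mu> (angular_sector u v w 0 a)"
      using angular_sector_add[OF f, of 0 "pi - c" a] a c by (cases "a = pi - c") auto
    with m0 m(1) p show False by simp
  qed
  show thesis
  proof (rule that[OF f a(1) c(1) _ m(3) m(1) _ m(4) m(2)])
    show "a + c < pi" using lt by simp
    show "measure \<mu> (angular_sector u v w a (pi - c)) = 1 / 2 - 2 * p"
      using angular_sector_add[OF f, of 0 a "pi - c"] m0 m(1) a c lt by simp
    have "measure \<mu> (angular_sector u v w pi (2 * pi - c)) = 1 / 2 - p"
      using angular_sector_add[OF f, of pi "2 * pi - c" "2 * pi"] m m' c by simp
    then show "measure \<mu> (angular_sector u v w (pi + a) (2 * pi - c)) = 1 / 2 - 2 * p"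
      using angular_sector_add[OF f, of pi "pi + a" "2 * pi - c"] m(2) a c lt by simp
  qed
qed

end

theorem theorem2p2:
  fixes \<mu> :: "(real^3) measure"
  assumes "prob_space \<mu>" and "proper_borel_measure \<mu>"
  shows "(\<exists>P Q R \<sigma>. fan_position P Q R \<and> cyclic_sectors P Q R \<sigma> \<and>
            map (measure \<mu>) \<sigma> = [1/8, 1/8, 2/8, 1/8, 1/8, 2/8]) \<and>
         (\<exists>P Q R \<sigma>. fan_position P Q R \<and> cyclic_sectors P Q R \<sigma> \<and>
            map (measure \<mu>) \<sigma> = [1/10, 2/10, 2/10, 1/10, 2/10, 2/10])"
proof
  interpret prob_space \<mu> by fact
  interpret sphere_measure \<mu> by unfold_locales fact
  obtain u v w a c where f: "orthonormal_frame u v w" and ac: "0 < a" "0 < c" "a + c < pi"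
    and m: "measure \<mu> (angular_sector u v w (- c) 0) = 1 / 8"
      "measure \<mu> (angular_sector u v w 0 a) = 1 / 8"
      "measure \<mu> (angular_sector u v w a (pi - c)) = 1 / 2 - 2 * (1 / 8)"
      "measure \<mu> (angular_sector u v w (pi - c) pi) = 1 / 8"
      "measure \<mu> (angular_sector u v w pi (pi + a)) = 1 / 8"
      "measure \<mu> (angular_sector u v w (pi + a) (2 * pi - c)) = 1 / 2 - 2 * (1 / 8)"
    by (rule balanced_fan[of "1 / 8"]) (simp, simp, rule that)
  show "\<exists>P Q R \<sigma>. fan_position P Q R \<and> cyclic_sectors P Q R \<sigma> \<and>
      map (measure \<mu>) \<sigma> = [1/8, 1/8, 2/8, 1/8, 1/8, 2/8]"
  proof (intro exI conjI)
    show "fan_position (plane_at u v (- c)) (plane_at u v 0) (plane_at u v a)"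
      using ac by (intro fan_position_plane_at[OF f]) auto
    show "cyclic_sectors (plane_at u v (- c)) (plane_at u v 0) (plane_at u v a)
      [angular_sector u v w (- c) 0, angular_sector u v w 0 a, angular_sector u v w a (- c + pi),
       angular_sector u v w (- c + pi) (0 + pi), angular_sector u v w (0 + pi) (a + pi),
       angular_sector u v w (a + pi) (- c + 2 * pi)]"
      using ac by (intro fan_cyclic_sectors[OF f]) auto
  qed (use m in \<open>simp add: add.commute\<close>)
next
  interpret prob_space \<mu> by fact
  interpret sphere_measure \<mu> by unfold_locales fact
  obtain u v w a c where f: "orthonormal_frame u v w" and ac: "0 < a" "0 < c" "a + c < pi"
    and m: "measure \<mu> (angular_sector u v w (- c) 0) = 1 / 5"
      "measure \<mu> (angular_sector u v w 0 a) = 1 / 5"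
      "measure \<mu> (angular_sector u v w a (pi - c)) = 1 / 2 - 2 * (1 / 5)"
      "measure \<mu> (angular_sector u v w (pi - c) pi) = 1 / 5"
      "measure \<mu> (angular_sector u v w pi (pi + a)) = 1 / 5"
      "measure \<mu> (angular_sector u v w (pi + a) (2 * pi - c)) = 1 / 2 - 2 * (1 / 5)"
    by (rule balanced_fan[of "1 / 5"]) (simp, simp, rule that)
  (* The list starts at angle a - pi, so that a sector of measure 1/10 comes first. *)
  have m': "measure \<mu> (angular_sector u v w (a - pi) (- c)) = 1 / 2 - 2 * (1 / 5)"
    using m(6) angular_sector_shift[of u v w "a - pi" "- c"] by (simp add: algebra_simps)
  show "\<exists>P Q R \<sigma>. fan_position P Q R \<and> cyclic_sectors P Q R \<sigma> \<and>
      map (measure \<mu>) \<sigma> = [1/10, 2/10, 2/10, 1/10, 2/10, 2/10]"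
  proof (intro exI conjI)
    show "fan_position (plane_at u v (a - pi)) (plane_at u v (- c)) (plane_at u v 0)"
      using ac by (intro fan_position_plane_at[OF f]) auto
    show "cyclic_sectors (plane_at u v (a - pi)) (plane_at u v (- c)) (plane_at u v 0)
      [angular_sector u v w (a - pi) (- c), angular_sector u v w (- c) 0, angular_sector u v w 0 (a - pi + pi),
       angular_sector u v w (a - pi + pi) (- c + pi), angular_sector u v w (- c + pi) (0 + pi),
       angular_sector u v w (0 + pi) (a - pi + 2 * pi)]"
      using ac by (intro fan_cyclic_sectors[OF f]) auto
  qed (use m m' in \<open>simp add: algebra_simps\<close>)
qed

end
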